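(* Consider the stable ($\rho<1$) $M/G/1$ retrial queue with Bernoulli schedule in steady state, and suppose that the service time $T_\beta$ satisfies $P\{T_\beta>t\}\sim t^{-a}L(t)$ as $t\to\infty$, where $a>1$ and $L$ is slowly varying at $\infty$. Then, as $j\to\infty$, $$P\{R_{que}>j\mid I_{ser}=1\}\;\sim\;\frac{\lambda_1^{a-1}}{(1-\rho_1)(a-1)\beta_1}\; j^{-a+1}L(j).$$
   Context: Model ($M/G/1$ retrial queue with Bernoulli schedule). Customers arrive according to a Poisson process with rate $\lambda>0$ at a single-server system that has a (priority) queue of infinite capacity and an orbit. A customer who finds the server idle on arrival is served immediately. A customer who finds the server busy joins the queue (first-in-first-out) with probability $q$, or the orbit with probability $p=1-q$, where $0<q<1$. At a service completion, if the queue is non-empty the customer at its head starts service; otherwise the server becomes idle. Each customer in the orbit independently retries according to a Poisson process with rate $\mu>0$ until finding the server idle, and is then served immediately. Customers leave after service. All service times are i.i.d. copies of $T_\beta$ with distribution function $F_\beta$, $F_\beta(0)=0$, finite mean $\beta_1$, and Laplace-Stieltjes transform (LST) $\beta(s)=E(e^{-sT_\beta})$; arrivals, services, routing choices and retrials are independent. Parameters: $\lambda_1=\lambda q$, $\lambda_2=\lambda p$, $\rho_1=\lambda_1\beta_1$, $\rho_2=\lambda_2\beta_1$, $\rho=\rho_1+\rho_2=\lambda\beta_1$. The system is stable if and only if $\rho<1$, which is assumed. In steady state, $R_{que}$ is the number of customers in the queue (excluding the one in service), $R_{orb}$ is the number of customers in the orbit, and $I_{ser}=1$ or $0$ according to whether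 the server is busy or idle. Known facts taken as the starting point (Choi and Park): $P\{I_{ser}=1\}=\rho$ and $$E(z_1^{R_{que}}z_2^{R_{orb}}\mid I_{ser}=1)=M_a(z_1,z_2)\,M_b(z_1,z_2)\,M_c(z_2)\,R_0(z_2),$$ where $$M_a(z_1,z_2)=\frac1\rho\cdot\frac{1-\beta(\lambda-\lambda_1z_1-\lambda_2z_2)}{1-pz_2-qz_1},\qquad M_b(z_1,z_2)=(1-\rho_1)\frac{h(z_2)-z_1}{\beta(\lambda-\lambda_1z_1-\lambda_2z_2)-z_1},$$ $$M_c(z_2)=\frac{1-\rho}{1-\rho_1}\cdot\frac{1-z_2}{h(z_2)-z_2},\qquad R_0(z_2)=\exp\Big\{-\frac{\lambda}{\mu}\int_{z_2}^1\frac{1-h(u)}{h(u)-u}\,du\Big\},$$ with removable singularities filled by continuity, and $h(z)$ is uniquely determined by $h(z)=\beta(\lambda-\lambda_1h(z)-\lambda_2z)$. Equivalently, $h(z)=\alpha(\lambda_2-\lambda_2z)$, where $\alpha$ is the LST of the busy period of the standard $M/G/1$ queue with arrival rate $\lambda_1$ and service time $T_\beta$, satisfying $\alpha(s)=\beta(s+\lambda_1-\lambda_1\alpha(s))$. A measurable $L:(0,\infty)\to(0,\infty)$ is slowly varying at $\infty$ if $\lim_{t\to\infty}L(xt)/L(t)=1$ for all $x>0$. The notation $f\sim g$ means $f/g\to1$. *)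

theory Defs
  imports "HOL-Probability.Probability" "HOL-Library.Landau_Symbols"
begin

definition slowly_varying :: "(real \<Rightarrow> real) \<Rightarrow> bool" where
  "slowly_varying L \<longleftrightarrow>
     L \<in> borel_measurable (restrict_space borel {0<..}) \<and>
     (\<forall>t>0. 0 < L t) \<and>
     (\<forall>x>0. ((\<lambda>t. L (x * t) / L t) \<longlongrightarrow> 1) at_top)"

text \<open>
  Throughout, \<open>lam\<close> is the arrival rate, \<open>q\<close> the probability of joining the queue (so that
  \<open>p = 1 - q\<close>), \<open>\<mu>\<close> the retrial rate of each customer in the orbit, and the measure \<open>S\<close> on the
  real line is the law of the service time.

  The system is described by the Markov process whose state records the server status, the
  number of customers in the queue, the number of customers in the orbit and, while the server
  is busy, the residual service time of the customer in service. \<open>Idle n\<close> has \<open>n\<close> customers in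
  the orbit; an idle server implies an empty queue. \<open>Busy i n r\<close> has \<open>i\<close> customers in the queue
  (not counting the one in service), \<open>n\<close> in the orbit and residual service time \<open>r\<close>.
\<close>

datatype rq_state = Idle nat | Busy nat nat real

primrec I_ser :: "rq_state \<Rightarrow> nat" where
  "I_ser (Idle n) = 0"
| "I_ser (Busy i n r) = 1"

primrec R_que :: "rq_state \<Rightarrow> nat" where
  "R_que (Idle n) = 0"
| "R_que (Busy i n r) = i"

primrec R_orb :: "rq_state \<Rightarrow> nat" where
  "R_orb (Idle n) = n"
| "R_orb (Busy i n r) = n"

primrec residual :: "rq_state \<Rightarrow> real" where
  "residual (Idle n) = 0"
| "residual (Busy i n r) = r"

definition rq_space :: "rq_state measure" where
  "rq_space = vimage_algebra UNIV (\<lambda>x. (I_ser x, R_que x, R_orb x, residual x))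
     (count_space UNIV \<Otimes>\<^sub>M count_space UNIV \<Otimes>\<^sub>M count_space UNIV \<Otimes>\<^sub>M borel)"

text \<open>
  Expectation of \<open>u\<close> when a customer with a fresh service time has just entered service,
  leaving \<open>i\<close> customers in the queue and \<open>n\<close> in the orbit.
\<close>

definition start_service :: "real measure \<Rightarrow> (rq_state \<Rightarrow> ennreal) \<Rightarrow> nat \<Rightarrow> nat \<Rightarrow> ennreal" where
  "start_service S u i n = (\<integral>\<^sup>+ r. u (Busy i n r) \<partial>S)"

text \<open>The same just after a service completion that found \<open>i\<close> customers in the queue.\<close>

definition end_service :: "real measure \<Rightarrow> (rq_state \<Rightarrow> ennreal) \<Rightarrow> nat \<Rightarrow> nat \<Rightarrow> ennreal" where
  "end_service S u i n = (case i of 0 \<Rightarrow> u (Idle n) | Suc i' \<Rightarrow> start_service S u i' n)"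

text \<open>
  \<open>rq_upto lam q \<mu> S f k t x\<close> is the expectation, starting in \<open>x\<close>, of \<open>f\<close> evaluated at the state
  at time \<open>t\<close>, restricted to the event that fewer than \<open>k\<close> transitions (arrivals, successful
  retrials, service completions) occur up to time \<open>t\<close>. It is given by conditioning on the first
  transition. In \<open>Idle n\<close> transitions occur at rate \<open>lam + n * \<mu>\<close>; in \<open>Busy i n r\<close> an arrival
  occurs at rate \<open>lam\<close> unless the residual service time \<open>r\<close> elapses first (retrials during a
  service have no effect).
\<close>

primrec rq_upto ::
  "real \<Rightarrow> real \<Rightarrow> real \<Rightarrow> real measure \<Rightarrow> (rq_state \<Rightarrow> ennreal) \<Rightarrow> nat \<Rightarrow> real \<Rightarrow> rq_state \<Rightarrow> ennreal"
where
  "rq_upto lam q \<mu> S f 0 = (\<lambda>t x. 0)"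
| "rq_upto lam q \<mu> S f (Suc k) = (\<lambda>t x. case x of
     Idle n \<Rightarrow>
       ennreal (exp (- (lam + real n * \<mu>) * t)) * f (Idle n)
       + (\<integral>\<^sup>+ s \<in> {0..t}. ennreal (exp (- (lam + real n * \<mu>) * s)) *
            (ennreal lam * start_service S (rq_upto lam q \<mu> S f k (t - s)) 0 n
             + ennreal (real n * \<mu>) * start_service S (rq_upto lam q \<mu> S f k (t - s)) 0 (n - 1))
          \<partial>lborel)
   | Busy i n r \<Rightarrow>
       (if t < r then ennreal (exp (- lam * t)) * f (Busy i n (r - t))
        else ennreal (exp (- lam * r)) * end_service S (rq_upto lam q \<mu> S f k (t - r)) i n)
       + (\<integral>\<^sup>+ s \<in> {0..min t r}. ennreal (exp (- lam * s)) *
            (ennreal (lam * q) * rq_upto lam q \<mu> S f k (t - s) (Busy (Suc i) n (r - s))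
             + ennreal (lam * (1 - q)) * rq_upto lam q \<mu> S f k (t - s) (Busy i (Suc n) (r - s)))
          \<partial>lborel))"

definition rq_transition ::
  "real \<Rightarrow> real \<Rightarrow> real \<Rightarrow> real measure \<Rightarrow> real \<Rightarrow> rq_state \<Rightarrow> rq_state set \<Rightarrow> ennreal"
where
  "rq_transition lam q \<mu> S t x A = (SUP k. rq_upto lam q \<mu> S (indicator A) k t x)"

text \<open>Stationary laws of the process; a customer in service has positive residual service time.\<close>

definition rq_steady_state ::
  "real \<Rightarrow> real \<Rightarrow> real \<Rightarrow> real measure \<Rightarrow> rq_state measure \<Rightarrow> bool"
where
  "rq_steady_state lam q \<mu> S \<nu> \<longleftrightarrow>
     prob_space \<nu> \<and> sets \<nu> = sets rq_space \<and>
     (AE x in \<nu>. I_ser x = 1 \<longrightarrow> 0 < residual x) \<and>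
     (\<forall>t\<ge>0. \<forall>A\<in>sets rq_space. (\<integral>\<^sup>+ x. rq_transition lam q \<mu> S t x A \<partial>\<nu>) = emeasure \<nu> A)"

definition mean_service :: "real measure \<Rightarrow> real" where
  "mean_service S = (\<integral>x. x \<partial>S)"

definition LST :: "real measure \<Rightarrow> real \<Rightarrow> real" where
  "LST S s = (\<integral>x. exp (- s * x) \<partial>S)"

text \<open>
  Ingredients of the Choi--Park formula. For \<open>0 \<le> z \<le> 1\<close> and \<open>lam * q * mean_service S < 1\<close> the
  fixed point equation has exactly one solution in the unit interval.
\<close>

definition rq_h :: "real \<Rightarrow> real \<Rightarrow> real measure \<Rightarrow> real \<Rightarrow> real" where
  "rq_h lam q S z =
     (THE x. 0 \<le> x \<and> x \<le> 1 \<and> x = LST S (lam - lam * q * x - lam * (1 - q) * z))"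

definition M_a :: "real \<Rightarrow> real \<Rightarrow> real measure \<Rightarrow> real \<Rightarrow> real \<Rightarrow> real" where
  "M_a lam q S z1 z2 =
     1 / (lam * mean_service S) *
     ((1 - LST S (lam - lam * q * z1 - lam * (1 - q) * z2)) / (1 - (1 - q) * z2 - q * z1))"

definition M_b :: "real \<Rightarrow> real \<Rightarrow> real measure \<Rightarrow> real \<Rightarrow> real \<Rightarrow> real" where
  "M_b lam q S z1 z2 =
     (1 - lam * q * mean_service S) *
     ((rq_h lam q S z2 - z1) / (LST S (lam - lam * q * z1 - lam * (1 - q) * z2) - z1))"

definition M_c :: "real \<Rightarrow> real \<Rightarrow> real measure \<Rightarrow> real \<Rightarrow> real" where
  "M_c lam q S z2 =
     (1 - lam * mean_service S) / (1 - lam * q * mean_service S) *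
     ((1 - z2) / (rq_h lam q S z2 - z2))"

definition R_0 :: "real \<Rightarrow> real \<Rightarrow> real \<Rightarrow> real measure \<Rightarrow> real \<Rightarrow> real" where
  "R_0 lam q \<mu> S z2 =
     exp (- (lam / \<mu>) * (LBINT u:{z2..1}. (1 - rq_h lam q S u) / (rq_h lam q S u - u)))"

text \<open>
  The formula is required only off the removable singularities, namely \<open>z2 = 1\<close> and
  \<open>z1 = rq_h lam q S z2\<close>; continuity fills in the remaining values.
\<close>

definition choi_park ::
  "real \<Rightarrow> real \<Rightarrow> real \<Rightarrow> real measure \<Rightarrow> rq_state measure \<Rightarrow> bool"
where
  "choi_park lam q \<mu> S \<nu> \<longleftrightarrow>
     measure \<nu> {x \<in> space \<nu>. I_ser x = 1} = lam * mean_service S \<and>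
     (\<forall>z1\<in>{0..1}. \<forall>z2\<in>{0..<1}. z1 \<noteq> rq_h lam q S z2 \<longrightarrow>
        (\<integral>x. z1 ^ R_que x * z2 ^ R_orb x \<partial>uniform_measure \<nu> {x \<in> space \<nu>. I_ser x = 1})
        = M_a lam q S z1 z2 * M_b lam q S z1 z2 * M_c lam q S z2 * R_0 lam q \<mu> S z2)"

end

(*
  Letting z2 tend to 1 in the Choi-Park formula removes the orbit: with c = lam * q the arrival
  rate to the queue, r = c * E T and K(z) = (1 - LST (c (1 - z))) / (1 - z), one gets
  E (z^R | busy) = (1 - r) / r * K(z) / (1 - K(z)), so R is a geometric compound sum. The
  coefficient g n of K is the probability of more than n Poisson arrivals at rate c during one
  service, and the tails Q j = P (R > j | busy) solve the defective renewal equation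
  Q j = W j / r + sum_{i <= j} g i * Q (j - i) with W j = sum_{n > j} g n.
  Poisson concentration gives g n ~ P (T > n / c), and Karamata's theorem makes W regularly
  varying of index 1 - a. In the renewal equation the indices i comparable with j are negligible,
  since g i = O(W j / j) there while Q tends to 0; hence Q j / W j has a limit x, and
  x = 1 / r + r * x. As the tail of T is monotone, no uniform convergence theorem for slowly
  varying functions is needed.
*)
theory Submission
  imports Defs "HOL-Real_Asymp.Real_Asymp"
begin

section \<open>Monotone regularly varying functions\<close>

text \<open>The factors \<open>M_c\<close> and \<open>R_0\<close> tend to 1 because \<open>h\<close>
  has slope \<kappa> < 1 at 1; given r < 1, the condition \<kappa> < 1 is equivalent to stability.
  Since (1 - r) / r * K / (1 - K) is the sum over n >= 0 of (1 - r) * r^n * (K / r)^(n + 1), a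
  summand of the compound sum is the number of arrivals during a stationary residual service time.
  Its tail is W j / r, whence the forcing term. A Tauberian argument at z = 1 would have to remove
  Taylor polynomials and to separate integer from non-integer a; on the level of coefficients all a
  > 1 are alike. The equation x = 1 / r + r * x identifies the limit only if Q / W is known to be
  bounded, so a crude bound by induction has to precede the comparison of upper and lower limits.
  The constant has three sources: P (T > j / c) against P (T > j) gives c^a, Karamata's theorem
  gives 1 / (a - 1), and x = 1 / (r * (1 - r)). As r = c * E T, one power of c cancels.\<close>

lemma power_bracket:
  fixes \<theta> x :: real
  assumes "1 < \<theta>" "1 \<le> x"
  shows "\<exists>k. \<theta> ^ k \<le> x \<and> x < \<theta> ^ Suc k"
proof -
  obtain n where "x < \<theta> ^ n" using real_arch_pow assms by blast
  then obtain m where m: "x < \<theta> ^ m" "\<And>i. i < m \<Longrightarrow> \<not> x < \<theta> ^ i"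
    using exists_least_iff[of "\<lambda>n. x < \<theta> ^ n"] by auto
  then obtain k where "m = Suc k" using assms by (cases m) auto
  then show ?thesis using m by (intro exI[of _ k]) (auto simp: not_less)
qed

text \<open>In the application \<open>f\<close> is a rescaled tail of the service law. It is
  positive and monotone on all of \<open>real\<close>, so no domain conditions arise, and the slowly
  varying factor is never split off from the power.\<close>

locale monotone_regvar =
  fixes f :: "real \<Rightarrow> real" and a :: real
  assumes pos: "0 < f t"
    and anti: "s \<le> t \<Longrightarrow> f t \<le> f s"
    and ratio: "0 < x \<Longrightarrow> ((\<lambda>t. f (x * t) / f t) \<longlongrightarrow> x powr - a) at_top"
begin

text \<open>Potter's bound. The limit is used at the single point \<open>\<theta>\<close> and
  iterated along its powers. Between powers \<open>x\<close> is rounded down and monotonicity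
  applies; this costs at most \<open>\<theta> powr b\<close>, and \<open>\<theta>\<close> is chosen
  to make that equal to \<open>K\<close>.\<close>

lemma potter_upper:
  assumes "0 < b" "b < a" "1 < K"
  shows "\<exists>t0>0. \<forall>t\<ge>t0. \<forall>x\<ge>1. f (x * t) \<le> K * x powr - b * f t"
proof -
  define \<theta> where "\<theta> = K powr (1 / b)"
  have th: "1 < \<theta>" "\<theta> powr b = K"
    using assms by (auto simp: \<theta>_def powr_powr)
  have "\<theta> powr - a < \<theta> powr - b"
    using assms th by simp
  then have "\<forall>\<^sub>F t in at_top. f (\<theta> * t) / f t < \<theta> powr - b"
    using ratio[of \<theta>] th by (intro order_tendstoD) auto
  then obtain t1 where "\<And>t. t \<ge> t1 \<Longrightarrow> f (\<theta> * t) / f t < \<theta> powr - b"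
    unfolding eventually_at_top_linorder by blast
  then have step: "f (\<theta> * t) \<le> \<theta> powr - b * f t" if "t \<ge> t1" for t
    using \<open>\<And>t. t \<ge> t1 \<Longrightarrow> f (\<theta> * t) / f t < \<theta> powr - b\<close>[OF that] pos[of t]
    by (simp add: pos_divide_less_eq less_imp_le)
  define t0 where "t0 = max t1 1"
  have iter: "f (\<theta> ^ k * t) \<le> (\<theta> ^ k) powr - b * f t" if "t \<ge> t0" for k t
  proof (induction k)
    case (Suc k)
    have "t1 \<le> 1 * t"
      using that by (simp add: t0_def)
    also have "\<dots> \<le> \<theta> ^ k * t"
      using that th by (intro mult_right_mono one_le_power) (auto simp: t0_def)
    finally have "t1 \<le> \<theta> ^ k * t" .
    then have "f (\<theta> * (\<theta> ^ k * t)) \<le> \<theta> powr - b * f (\<theta> ^ k * t)"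
      by (rule step)
    also have "\<dots> \<le> \<theta> powr - b * ((\<theta> ^ k) powr - b * f t)"
      by (intro mult_left_mono Suc) auto
    also have "\<dots> = (\<theta> ^ Suc k) powr - b * f t"
      using th by (simp add: powr_mult)
    finally show ?case by (simp add: mult_ac)
  qed (use th in auto)
  have "f (x * t) \<le> K * x powr - b * f t" if "t \<ge> t0" and x: "1 \<le> x" for x t
  proof -
    obtain k where k: "\<theta> ^ k \<le> x" "x < \<theta> ^ Suc k"
      using power_bracket[OF th(1) x] by blast
    have "\<theta> ^ k * t \<le> x * t"
      using k that by (intro mult_right_mono) (auto simp: t0_def)
    then have "f (x * t) \<le> (\<theta> ^ k) powr - b * f t"
      using anti iter[OF that(1), of k] order_trans by blast
    also have "(\<theta> ^ k) powr - b \<le> (x / \<theta>) powr - b"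
      using k th that assms by (intro powr_mono2') (auto simp: field_simps)
    also have "(x / \<theta>) powr - b = K * x powr - b"
      using th that by (simp add: powr_divide powr_minus field_simps)
    finally show ?thesis using pos[of t] by simp
  qed
  then show ?thesis
    by (intro exI[of _ t0]) (auto simp: t0_def)
qed

text \<open>The mirror image of \<open>potter_upper\<close>: an exponent \<open>c\<close> beyond
  \<open>a\<close> leaves room at the point \<open>\<theta>\<close>, and \<open>x\<close> is rounded
  up to the next power, at the cost of the factor \<open>\<theta> powr c = K\<close>.\<close>

lemma potter_lower:
  assumes "0 < a" "a < c" "1 < K"
  shows "\<exists>t0>0. \<forall>t\<ge>t0. \<forall>x\<ge>1. x powr - c * f t \<le> K * f (x * t)"
proof -
  define \<theta> where "\<theta> = K powr (1 / c)"
  have th: "1 < \<theta>" "\<theta> powr c = K"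
    using assms by (auto simp: \<theta>_def powr_powr)
  have "\<theta> powr - c < \<theta> powr - a"
    using assms th by simp
  then have "\<forall>\<^sub>F t in at_top. \<theta> powr - c < f (\<theta> * t) / f t"
    using ratio[of \<theta>] th by (intro order_tendstoD) auto
  then obtain t1 where "\<And>t. t \<ge> t1 \<Longrightarrow> \<theta> powr - c < f (\<theta> * t) / f t"
    unfolding eventually_at_top_linorder by blast
  then have step: "\<theta> powr - c * f t \<le> f (\<theta> * t)" if "t \<ge> t1" for t
    using \<open>\<And>t. t \<ge> t1 \<Longrightarrow> \<theta> powr - c < f (\<theta> * t) / f t\<close>[OF that] pos[of t]
    by (simp add: pos_less_divide_eq less_imp_le)
  define t0 where "t0 = max t1 1"
  have iter: "(\<theta> ^ k) powr - c * f t \<le> f (\<theta> ^ k * t)" if "t \<ge> t0" for k t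
  proof (induction k)
    case (Suc k)
    have "t1 \<le> 1 * t"
      using that by (simp add: t0_def)
    also have "\<dots> \<le> \<theta> ^ k * t"
      using that th by (intro mult_right_mono one_le_power) (auto simp: t0_def)
    finally have "t1 \<le> \<theta> ^ k * t" .
    then have *: "\<theta> powr - c * f (\<theta> ^ k * t) \<le> f (\<theta> * (\<theta> ^ k * t))"
      by (rule step)
    have "(\<theta> ^ Suc k) powr - c * f t = \<theta> powr - c * ((\<theta> ^ k) powr - c * f t)"
      using th by (simp add: powr_mult)
    also have "\<dots> \<le> \<theta> powr - c * f (\<theta> ^ k * t)"
      by (intro mult_left_mono Suc) auto
    also note *
    finally show ?case by (simp add: mult_ac)
  qed (use th in auto)
  have "x powr - c * f t \<le> K * f (x * t)" if "t \<ge> t0" and x: "1 \<le> x" for x t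
  proof -
    obtain k where k: "\<theta> ^ k \<le> x" "x < \<theta> ^ Suc k"
      using power_bracket[OF th(1) x] by blast
    have "x * t \<le> \<theta> ^ Suc k * t"
      using k that by (intro mult_right_mono) (auto simp: t0_def)
    then have "(\<theta> ^ Suc k) powr - c * f t \<le> f (x * t)"
      using anti iter[OF that(1), of "Suc k"] order_trans by blast
    moreover have "(x * \<theta>) powr - c \<le> (\<theta> ^ Suc k) powr - c"
      using k th that assms by (intro powr_mono2') (auto simp: field_simps)
    ultimately have "(x * \<theta>) powr - c * f t \<le> f (x * t)"
      using pos[of t] by (meson order_trans mult_right_mono less_imp_le)
    moreover have "(x * \<theta>) powr - c = x powr - c / K"
      using th that by (simp add: powr_mult powr_minus divide_inverse flip: th(2))
    ultimately have "x powr - c / K * f t \<le> f (x * t)" by simp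
    then show ?thesis using assms by (simp add: pos_divide_le_eq mult.commute)
  qed
  then show ?thesis
    by (intro exI[of _ t0]) (auto simp: t0_def)
qed

end

section \<open>Tail sums of powers by comparison with integrals\<close>

lemma powr_difference_bounds:
  assumes "1 < b" "0 < (y::real)"
  shows "(y + 1) powr - b \<le> (y powr (1 - b) - (y + 1) powr (1 - b)) / (b - 1)"
    and "(y powr (1 - b) - (y + 1) powr (1 - b)) / (b - 1) \<le> y powr - b"
proof -
  \<comment> \<open>The quotient in the statement is the integral of \<open>x powr - b\<close> from
    \<open>y\<close> to \<open>y + 1\<close>; the mean value theorem turns it into one value of the
    integrand.\<close>
  have "\<exists>z>y. z < y + 1 \<and> (y + 1) powr (1 - b) - y powr (1 - b) = (y + 1 - y) * ((1 - b) * z powr (1 - b - 1))"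
    using assms by (intro MVT2) (auto intro!: derivative_eq_intros)
  then obtain z where z: "y < z" "z < y + 1"
    "(y + 1) powr (1 - b) - y powr (1 - b) = (1 - b) * z powr - b"
    by auto
  then have eq: "(y powr (1 - b) - (y + 1) powr (1 - b)) / (b - 1) = z powr - b"
    using assms by (simp add: field_simps)
  show "(y + 1) powr - b \<le> (y powr (1 - b) - (y + 1) powr (1 - b)) / (b - 1)"
    unfolding eq using z assms by (intro powr_mono2') auto
  show "(y powr (1 - b) - (y + 1) powr (1 - b)) / (b - 1) \<le> y powr - b"
    unfolding eq using z assms by (intro powr_mono2') auto
qed

lemma powr_telescope_sums:
  assumes "1 < b"
  shows "(\<lambda>n. ((y + real n) powr (1 - b) - (y + real (Suc n)) powr (1 - b)) / (b - 1))
    sums (y powr (1 - b) / (b - 1))"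
proof -
  have "(\<lambda>n. (y + real n) powr (1 - b)) \<longlonglongrightarrow> 0"
    using assms by real_asymp
  from telescope_sums'[OF this]
  have "(\<lambda>n. (y + real n) powr (1 - b) - (y + real (Suc n)) powr (1 - b)) sums (y powr (1 - b))"
    by simp
  then show ?thesis by (rule sums_divide)
qed

lemma powr_tail_upper:
  assumes "1 < b" "0 < y"
  shows "summable (\<lambda>n. (y + real (Suc n)) powr - b)"
    and "(\<Sum>n. (y + real (Suc n)) powr - b) \<le> y powr (1 - b) / (b - 1)"
proof -
  have le: "(y + real (Suc n)) powr - b
      \<le> ((y + real n) powr (1 - b) - (y + real (Suc n)) powr (1 - b)) / (b - 1)" for n
    using powr_difference_bounds(1)[of b "y + real n"] assms by (simp add: add_ac)
  note T = powr_telescope_sums[OF assms(1), of y]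
  show S: "summable (\<lambda>n. (y + real (Suc n)) powr - b)"
    by (rule summable_comparison_test'[OF sums_summable[OF T]]) (use le in auto)
  show "(\<Sum>n. (y + real (Suc n)) powr - b) \<le> y powr (1 - b) / (b - 1)"
    using suminf_le[OF le S sums_summable[OF T]] sums_unique[OF T] by simp
qed

text \<open>Each term is compared with the integral over the unit interval to its right, so the
  primitive is evaluated at \<open>y + 1\<close>, the argument of the leading term. In
  \<open>karamata_lower\<close> this shift becomes the factor
  \<open>(1 + 1 / real j) powr (1 - c)\<close>, which tends to 1.\<close>

lemma powr_tail_lower:
  assumes "1 < b" "0 < y"
  shows "(y + 1) powr (1 - b) / (b - 1) \<le> (\<Sum>n. (y + real (Suc n)) powr - b)"
proof -
  have le: "((y + 1 + real n) powr (1 - b) - (y + 1 + real (Suc n)) powr (1 - b)) / (b - 1)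
      \<le> (y + real (Suc n)) powr - b" for n
    using powr_difference_bounds(2)[of b "y + 1 + real n"] assms by (simp add: add_ac)
  note T = powr_telescope_sums[OF assms(1), of "y + 1"]
  show ?thesis
    using suminf_le[OF le sums_summable[OF T] powr_tail_upper(1)[OF assms]] sums_unique[OF T] by simp
qed

section \<open>Karamata's theorem for sums\<close>

context monotone_regvar
begin

text \<open>Potter's lower bound from the fixed base point \<open>t0\<close> shows that
  \<open>f\<close> decays at most polynomially. This makes exponentially small Chernoff errors
  negligible against \<open>f\<close>.\<close>

lemma power_over_f_tendsto_zero:
  assumes "0 < a" "0 < r" "r < 1"
  shows "(\<lambda>n. r ^ n / f (real n)) \<longlonglongrightarrow> 0"
proof -
  \<comment> \<open>Any exponent larger than \<open>a\<close> would serve.\<close>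
  define c where "c = a + 1"
  obtain t0 where t0: "t0 > 0" "\<And>t x. t \<ge> t0 \<Longrightarrow> x \<ge> 1 \<Longrightarrow> x powr - c * f t \<le> 2 * f (x * t)"
    using potter_lower[of c 2] assms by (auto simp: c_def)
  define C where "C = 2 / (t0 powr c * f t0)"
  have lim: "(\<lambda>n. C * (r ^ n * real n powr c)) \<longlonglongrightarrow> 0"
  proof -
    have "(\<lambda>n. r ^ n * real n powr c) \<longlonglongrightarrow> 0" using assms by real_asymp
    from tendsto_mult_left[OF this, of C] show ?thesis by simp
  qed
  have ev: "\<forall>\<^sub>F n in sequentially. norm (r ^ n / f (real n)) \<le> C * (r ^ n * real n powr c)"
  proof -
    have "\<forall>\<^sub>F n in sequentially. t0 < real n" by real_asymp
    then show ?thesis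
    proof eventually_elim
      case (elim n)
      have "(real n / t0) powr - c * f t0 \<le> 2 * f (real n / t0 * t0)"
        using elim t0(1) by (intro t0(2)) auto
      then have "(real n / t0) powr - c * f t0 / 2 \<le> f (real n)"
        using t0(1) by simp
      moreover have P: "0 < (real n / t0) powr - c * f t0 / 2"
        using t0(1) elim pos[of t0] by simp
      ultimately have "r ^ n / f (real n) \<le> r ^ n / ((real n / t0) powr - c * f t0 / 2)"
        using assms by (intro divide_left_mono) (auto simp: pos)
      also have "\<dots> = C * (r ^ n * real n powr c)"
        using t0(1) elim by (simp add: C_def powr_divide powr_minus divide_simps)
      finally show ?case using assms pos[of "real n"] by simp
    qed
  qed
  show ?thesis
    by (rule Lim_null_comparison[OF ev lim])
qed

text \<open>Potter's bound with base point \<open>j\<close> and scale \<open>(j + n + 1) / j\<close>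
  replaces the tail sum of \<open>f\<close> by a tail sum of powers. The losses \<open>b < a\<close>
  and \<open>1 < K\<close> are removed only in \<open>karamata_tail_sum\<close>.\<close>

lemma karamata_upper:
  assumes "1 < b" "b < a" "1 < K"
  shows "\<forall>\<^sub>F j in sequentially. summable (\<lambda>n. f (real (j + Suc n))) \<and>
     (\<Sum>n. f (real (j + Suc n))) \<le> K / (b - 1) * (real j * f (real j))"
proof -
  obtain t0 where t0: "t0 > 0" "\<And>t x. t \<ge> t0 \<Longrightarrow> x \<ge> 1 \<Longrightarrow> f (x * t) \<le> K * x powr - b * f t"
    using potter_upper[of b K] assms by auto
  obtain N where N: "real N \<ge> t0"
    using real_arch_simple by blast
  have "summable (\<lambda>n. f (real (j + Suc n))) \<and>
     (\<Sum>n. f (real (j + Suc n))) \<le> K / (b - 1) * (real j * f (real j))" if "j \<ge> N" for j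
  proof -
    have j: "real j \<ge> t0" "real j > 0"
      using that N t0 by linarith+
    let ?g = "\<lambda>n. (K * f j * real j powr b) * (real j + real (Suc n)) powr - b"
    have le: "f (real (j + Suc n)) \<le> ?g n" for n
    proof -
      have "f ((real j + real (Suc n)) / real j * real j)
          \<le> K * ((real j + real (Suc n)) / real j) powr - b * f (real j)"
        using j by (intro t0) (auto simp: field_simps)
      also have "\<dots> = ?g n"
        using j by (simp add: powr_divide powr_minus field_simps)
      finally show ?thesis using j by (simp add: add_ac)
    qed
    note T = powr_tail_upper[OF assms(1) j(2)]
    have S: "summable ?g"
      by (rule summable_mult[OF T(1)])
    have S': "summable (\<lambda>n. f (real (j + Suc n)))"
      by (rule summable_comparison_test'[OF S]) (use le pos in \<open>auto simp: less_imp_le\<close>)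
    have "(\<Sum>n. f (real (j + Suc n))) \<le> (\<Sum>n. ?g n)"
      by (rule suminf_le[OF le S' S])
    also have "\<dots> = (K * f j * real j powr b) * (\<Sum>n. (real j + real (Suc n)) powr - b)"
      by (rule suminf_mult[OF T(1)])
    also have "\<dots> \<le> (K * f j * real j powr b) * (real j powr (1 - b) / (b - 1))"
      using assms pos[of j] by (intro mult_left_mono T(2)) auto
    also have "\<dots> = K / (b - 1) * (real j * f (real j))"
      using j assms by (simp add: powr_diff)
    finally show ?thesis using S' by simp
  qed
  then show ?thesis
    unfolding eventually_sequentially by blast
qed

lemma summable_values:
  assumes "1 < a"
  shows "summable (\<lambda>n. f (real n))"
proof -
  obtain b where "1 < b" "b < a" using dense assms by blast
  then obtain j where "summable (\<lambda>n. f (real (j + Suc n)))"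
    using karamata_upper[of b 2] by (auto simp: eventually_sequentially)
  then show ?thesis
    using summable_iff_shift[of "\<lambda>n. f (real n)" "Suc j"] by (simp add: add_ac)
qed

lemma karamata_lower:
  assumes "1 < a" "a < c" "1 < K"
  shows "\<forall>\<^sub>F j in sequentially.
     (1 + 1 / real j) powr (1 - c) / (K * (c - 1)) * (real j * f (real j)) \<le> (\<Sum>n. f (real (j + Suc n)))"
proof -
  obtain t0 where t0: "t0 > 0" "\<And>t x. t \<ge> t0 \<Longrightarrow> x \<ge> 1 \<Longrightarrow> x powr - c * f t \<le> K * f (x * t)"
    using potter_lower[of c K] assms by auto
  obtain N where N: "real N \<ge> t0"
    using real_arch_simple by blast
  have "(1 + 1 / real j) powr (1 - c) / (K * (c - 1)) * (real j * f (real j)) \<le> (\<Sum>n. f (real (j + Suc n)))"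
    if "j \<ge> N" for j
  proof -
    have j: "real j \<ge> t0" "real j > 0"
      using that N t0 by linarith+
    let ?g = "\<lambda>n. (f j * real j powr c / K) * (real j + real (Suc n)) powr - c"
    have le: "?g n \<le> f (real (j + Suc n))" for n
    proof -
      have "((real j + real (Suc n)) / real j) powr - c * f (real j)
          \<le> K * f ((real j + real (Suc n)) / real j * real j)"
        using j by (intro t0) (auto simp: field_simps)
      also have "(real j + real (Suc n)) / real j * real j = real (j + Suc n)"
        using j by simp
      finally have "((real j + real (Suc n)) / real j) powr - c * f (real j) / K \<le> f (real (j + Suc n))"
        using assms by (simp add: field_simps)
      also have "((real j + real (Suc n)) / real j) powr - c * f (real j) / K = ?g n"
        using j assms by (simp add: powr_divide powr_minus field_simps)
      finally show ?thesis .
    qed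
    have c: "1 < c" using assms by simp
    note T = powr_tail_upper(1)[OF c j(2)]
    have S: "summable ?g"
      by (rule summable_mult[OF T])
    have S': "summable (\<lambda>n. f (real (j + Suc n)))"
      using summable_values[OF assms(1)] summable_iff_shift[of "\<lambda>n. f (real n)" "Suc j"]
      by (simp add: add_ac)
    have "(1 + 1 / real j) powr (1 - c) / (K * (c - 1)) * (real j * f (real j))
        = (f j * real j powr c / K) * ((real j + 1) powr (1 - c) / (c - 1))"
    proof -
      have "1 + 1 / real j = (real j + 1) / real j" using j by (simp add: field_simps)
      then have "(1 + 1 / real j) powr (1 - c) = (real j + 1) powr (1 - c) / real j powr (1 - c)"
        using j by (simp add: powr_divide)
      also have "\<dots> = (real j + 1) powr (1 - c) * real j powr c / real j"
        using j by (simp add: powr_diff)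
      finally show ?thesis using j by simp
    qed
    also have "\<dots> \<le> (f j * real j powr c / K) * (\<Sum>n. (real j + real (Suc n)) powr - c)"
      using assms pos[of j] by (intro mult_left_mono powr_tail_lower c j) auto
    also have "\<dots> = (\<Sum>n. ?g n)"
      by (rule suminf_mult[OF T, symmetric])
    also have "\<dots> \<le> (\<Sum>n. f (real (j + Suc n)))"
      by (rule suminf_le[OF le S S'])
    finally show ?thesis .
  qed
  then show ?thesis
    unfolding eventually_sequentially by blast
qed

lemma karamata_tail_sum:
  assumes "1 < a"
  shows "(\<lambda>j. (\<Sum>n. f (real (j + Suc n))) / (real j * f (real j))) \<longlonglongrightarrow> 1 / (a - 1)"
proof (rule order_tendstoI)
  fix u assume u: "1 / (a - 1) < u"
  have "0 < 1 / (a - 1)" using assms by simp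
  then have u0: "0 < u" using u by linarith
  \<comment> \<open>This is \<open>1 / (a - 1) < u\<close> solved for \<open>a\<close>; it leaves
    room for an exponent \<open>b\<close> with \<open>1 / (b - 1) < u\<close>, and then for a factor
    \<open>K\<close> with \<open>K / (b - 1) < u\<close>.\<close>
  have "1 + 1 / u < a"
    using u u0 assms by (simp add: field_simps)
  then obtain b where b: "1 + 1 / u < b" "b < a" using dense by blast
  moreover have b1: "1 < b" using b u0 by (smt (verit) divide_pos_pos)
  ultimately have "1 < u * (b - 1)"
    using u0 by (simp add: field_simps)
  then obtain K where K: "1 < K" "K < u * (b - 1)" using dense by blast
  then have Ku: "K / (b - 1) < u" using b1 by (simp add: field_simps)
  show "\<forall>\<^sub>F j in sequentially. (\<Sum>n. f (real (j + Suc n))) / (real j * f (real j)) < u"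
    using karamata_upper[OF b1 b(2) K(1)] eventually_gt_at_top[of 0]
  proof (eventually_elim, goal_cases)
    case (1 j)
    have P: "0 < real j * f (real j)" using 1 pos[of j] by simp
    then have "(\<Sum>n. f (real (j + Suc n))) / (real j * f (real j)) \<le> K / (b - 1)"
      using 1 by (subst pos_divide_le_eq) auto
    then show ?case using Ku by simp
  qed
next
  fix l assume l: "l < 1 / (a - 1)"
  \<comment> \<open>The bound \<open>l\<close> may be negative or zero; \<open>l'\<close> is
    positive, so that it can be inverted in the choice of \<open>c\<close> and
    \<open>K\<close>.\<close>
  obtain l' where l': "max l 0 < l'" "l' < 1 / (a - 1)"
    using dense[of "max l 0" "1 / (a - 1)"] l assms by auto
  have "a < 1 + 1 / l'"
    using l' assms by (simp add: field_simps)
  then obtain c where c: "a < c" "c < 1 + 1 / l'" using dense by blast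
  have "l' * (c - 1) < 1" using c l' by (simp add: field_simps)
  then have "1 < 1 / (l' * (c - 1))" using l' c assms by simp
  then obtain K where K: "1 < K" "K < 1 / (l' * (c - 1))" using dense by blast
  have Kc: "0 < K * (c - 1)" using K c assms by simp
  have "l' < 1 / (K * (c - 1))" using K Kc l' c assms by (simp add: field_simps)
  moreover have "(\<lambda>j. (1 + 1 / real j) powr (1 - c) / (K * (c - 1))) \<longlonglongrightarrow> 1 powr (1 - c) / (K * (c - 1))"
  proof (intro tendsto_divide tendsto_powr tendsto_const)
    show "(\<lambda>j. 1 + 1 / real j) \<longlonglongrightarrow> 1" by real_asymp
  qed (use Kc in auto)
  ultimately have "\<forall>\<^sub>F j in sequentially. l' < (1 + 1 / real j) powr (1 - c) / (K * (c - 1))"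
    by (intro order_tendstoD) auto
  then show "\<forall>\<^sub>F j in sequentially. l < (\<Sum>n. f (real (j + Suc n))) / (real j * f (real j))"
    using karamata_lower[OF assms c(1) K(1)] eventually_gt_at_top[of 0]
  proof (eventually_elim, goal_cases)
    case (1 j)
    have P: "0 < real j * f (real j)" using 1 pos[of j] by simp
    then have "(1 + 1 / real j) powr (1 - c) / (K * (c - 1)) \<le> (\<Sum>n. f (real (j + Suc n))) / (real j * f (real j))"
      using 1 by (subst pos_le_divide_eq) auto
    then show ?case using 1 l' by simp
  qed
qed

end

section \<open>A defective renewal equation\<close>

text \<open>Cesaro averaging. In the renewal equation it absorbs the large indices: once
  \<open>k i\<close> is bounded by a multiple of \<open>w j / j\<close>, what remains of the
  convolution is an average of \<open>r\<close>.\<close>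

lemma average_tendsto_zero:
  fixes r :: "nat \<Rightarrow> real"
  assumes "r \<longlonglongrightarrow> 0"
  shows "(\<lambda>j. (\<Sum>i\<le>j. r i) / real j) \<longlonglongrightarrow> 0"
proof (rule LIMSEQ_I)
  fix e :: real assume e: "0 < e"
  obtain N where N: "\<And>n. n \<ge> N \<Longrightarrow> \<bar>r n\<bar> < e / 3"
    using LIMSEQ_D[OF assms, of "e / 3"] e by auto
  define C where "C = (\<Sum>i<N. \<bar>r i\<bar>)"
  obtain M where M: "real M > 3 * C / e"
    using reals_Archimedean2 by blast
  have "norm ((\<Sum>i\<le>j. r i) / real j - 0) < e" if "j \<ge> max (max M N) 1" for j
  proof -
    have j: "real j \<ge> 1" "j \<ge> N" "real j > 3 * C / e" using that M by auto
    have "\<bar>\<Sum>i\<le>j. r i\<bar> \<le> (\<Sum>i\<le>j. \<bar>r i\<bar>)" by (rule sum_abs)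
    also have "\<dots> = C + (\<Sum>i=N..j. \<bar>r i\<bar>)"
    proof -
      have "{..j} = {..<N} \<union> {N..j}" using j by auto
      then show ?thesis by (simp add: C_def sum.union_disjoint ivl_disj_int)
    qed
    also have "(\<Sum>i=N..j. \<bar>r i\<bar>) \<le> (\<Sum>i=N..j. e / 3)"
      using N by (intro sum_mono less_imp_le) auto
    also have "\<dots> \<le> (real j + 1) * (e / 3)"
      using j e by (simp add: mult_right_mono)
    also have "\<dots> \<le> 2 * real j * (e / 3)"
      using j e by (intro mult_right_mono) auto
    finally have "\<bar>\<Sum>i\<le>j. r i\<bar> \<le> C + 2 * real j * (e / 3)" by simp
    moreover have "C < real j * (e / 3)"
      using j(3) e by (simp add: field_simps)
    ultimately have "\<bar>\<Sum>i\<le>j. r i\<bar> < e * real j" by (simp add: field_simps)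
    then show ?thesis using j by (simp add: pos_divide_less_eq)
  qed
  then show "\<exists>no. \<forall>n\<ge>no. norm ((\<Sum>i\<le>n. r i) / real n - 0) < e" by blast
qed

text \<open>\<open>k\<close> has total mass \<rho> < 1, hence defective. \<open>w_regular\<close>
  and \<open>k_small\<close> are the two consequences of regular variation on which the argument
  rests: \<open>w\<close> changes by a factor close to 1 over a short relative range, and a single
  \<open>k i\<close> with \<open>i\<close> of order \<open>j\<close> is of order
  \<open>w j / j\<close>.\<close>

locale defective_renewal =
  fixes k w r :: "nat \<Rightarrow> real" and \<rho> :: real
  assumes k_nonneg: "0 \<le> k i" and k_sums: "k sums \<rho>" and rho_less: "\<rho> < 1"
    and w_pos: "0 < w j" and w_dec: "i \<le> j \<Longrightarrow> w j \<le> w i"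
    and r_nonneg: "0 \<le> r j" and r_zero: "r \<longlonglongrightarrow> 0"
    and renewal: "r j = w j + (\<Sum>i\<le>j. k i * r (j - i))"
    and w_regular: "1 < b \<Longrightarrow> \<exists>\<epsilon>>0. \<epsilon> < 1 \<and>
      (\<forall>\<^sub>F j in sequentially. \<forall>i. real i \<le> \<epsilon> * real j \<longrightarrow> w (j - i) \<le> b * w j)"
    and k_small: "0 < \<epsilon> \<Longrightarrow> \<exists>C. \<forall>\<^sub>F j in sequentially. \<forall>i\<le>j. \<epsilon> * real j < real i \<longrightarrow> real j * k i \<le> C * w j"
begin

abbreviation D :: "nat \<Rightarrow> real" where "D j \<equiv> r j / w j"

lemma rho_nonneg: "0 \<le> \<rho>"
  using sums_le[OF k_nonneg sums_zero k_sums] by simp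

lemma partial_le: "(\<Sum>i\<in>A. k i) \<le> \<rho>" if "finite A"
  using sum_le_suminf[OF sums_summable[OF k_sums] that] k_nonneg k_sums by (simp add: sums_iff)

lemma D_nonneg: "0 \<le> D j"
  using r_nonneg[of j] w_pos[of j] by simp

text \<open>The convolution is cut at \<open>\<epsilon> * real j\<close>. Below the cut
  \<open>w (j - i)\<close> is at most \<open>b * w j\<close> and the mass of \<open>k\<close> is at
  most \<rho>; above it \<open>k_small\<close> leaves an average of \<open>r\<close>, which is
  eventually below \<delta>. The threshold for \<open>j\<close> does not depend on \<open>M\<close>:
  the proof of boundedness needs an \<open>M\<close> that varies with \<open>j\<close>.\<close>

lemma upper_step:
  assumes "1 < b" "0 < \<delta>"
  shows "\<exists>\<epsilon>>0. \<epsilon> < 1 \<and> (\<forall>\<^sub>F j in sequentially. \<forall>M.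
     (\<forall>m\<le>j. (1 - \<epsilon>) * real j \<le> real m \<longrightarrow> D m \<le> M) \<longrightarrow> D j \<le> 1 + \<delta> + b * \<rho> * M)"
proof -
  obtain \<epsilon> where eps: "0 < \<epsilon>" "\<epsilon> < 1"
    and reg: "\<forall>\<^sub>F j in sequentially. \<forall>i. real i \<le> \<epsilon> * real j \<longrightarrow> w (j - i) \<le> b * w j"
    using w_regular[OF assms(1)] by blast
  obtain C where C: "\<forall>\<^sub>F j in sequentially. \<forall>i\<le>j. \<epsilon> * real j < real i \<longrightarrow> real j * k i \<le> C * w j"
    using k_small[OF eps(1)] by blast
  have "(\<lambda>j. \<bar>C\<bar> * ((\<Sum>i\<le>j. r i) / real j)) \<longlonglongrightarrow> \<bar>C\<bar> * 0"
    by (intro tendsto_mult_left average_tendsto_zero r_zero)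
  then have "\<forall>\<^sub>F j in sequentially. \<bar>C\<bar> * ((\<Sum>i\<le>j. r i) / real j) < \<delta>"
    using assms by (intro order_tendstoD) auto
  with reg C eventually_gt_at_top[of 0]
  have "\<forall>\<^sub>F j in sequentially. \<forall>M.
     (\<forall>m\<le>j. (1 - \<epsilon>) * real j \<le> real m \<longrightarrow> D m \<le> M) \<longrightarrow> D j \<le> 1 + \<delta> + b * \<rho> * M"
  proof (eventually_elim)
    case (elim j)
    show ?case
    proof (intro allI impI)
      fix M assume "\<forall>m\<le>j. (1 - \<epsilon>) * real j \<le> real m \<longrightarrow> D m \<le> M"
      note reg = elim(1)[rule_format] and C = elim(2)[rule_format] and avg = elim(4) and M = this[rule_format]
      have j: "0 < real j" using elim by simp
      have "(1 - \<epsilon>) * real j \<le> 1 * real j" using eps by (intro mult_right_mono) auto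
      then have M0: "0 \<le> M" using M[of j] D_nonneg[of j] by linarith
      let ?A = "{i. i \<le> j \<and> real i \<le> \<epsilon> * real j}" and ?B = "{i. i \<le> j \<and> \<epsilon> * real j < real i}"
      have near: "k i * r (j - i) \<le> M * (b * w j) * k i" if "i \<in> ?A" for i
      proof -
        have "(1 - \<epsilon>) * real j \<le> real (j - i)" using that by (simp add: of_nat_diff algebra_simps)
        then have "r (j - i) \<le> M * w (j - i)"
          using M[of "j - i"] w_pos[of "j - i"] by (simp add: pos_divide_le_eq)
        also have "\<dots> \<le> M * (b * w j)"
          using reg[of i] that M0 by (intro mult_left_mono) auto
        finally show ?thesis using k_nonneg[of i] by (simp add: mult_left_mono mult.commute)
      qed
      have far: "k i * r (j - i) \<le> (\<bar>C\<bar> * w j / real j) * r (j - i)" if "i \<in> ?B" for i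
      proof -
        have "real j * k i \<le> C * w j" using C[of i] that by auto
        also have "\<dots> \<le> \<bar>C\<bar> * w j" using w_pos[of j] by (intro mult_right_mono) auto
        finally have "k i \<le> \<bar>C\<bar> * w j / real j" using j by (simp add: field_simps)
        then show ?thesis by (intro mult_right_mono r_nonneg)
      qed
      have "{..j} = ?A \<union> ?B" by auto
      then have "(\<Sum>i\<le>j. k i * r (j - i)) = (\<Sum>i\<in>?A. k i * r (j - i)) + (\<Sum>i\<in>?B. k i * r (j - i))"
        by (simp only:) (intro sum.union_disjoint, auto)
      also have "(\<Sum>i\<in>?A. k i * r (j - i)) \<le> M * (b * w j) * (\<Sum>i\<in>?A. k i)"
        unfolding sum_distrib_left by (intro sum_mono near)
      also have "\<dots> \<le> M * (b * w j) * \<rho>"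
        using M0 assms w_pos[of j] by (intro mult_left_mono partial_le) auto
      also have "(\<Sum>i\<in>?B. k i * r (j - i)) \<le> (\<Sum>i\<in>?B. (\<bar>C\<bar> * w j / real j) * r (j - i))"
        by (intro sum_mono far)
      also have "\<dots> \<le> (\<Sum>i\<le>j. (\<bar>C\<bar> * w j / real j) * r (j - i))"
        using w_pos[of j] r_nonneg by (intro sum_mono2) auto
      also have "\<dots> = (\<bar>C\<bar> * w j / real j) * (\<Sum>i\<le>j. r i)"
        unfolding sum_distrib_left[symmetric]
        using sum.nat_diff_reindex[of r "Suc j"] by (simp add: lessThan_Suc_atMost)
      also have "\<dots> = w j * (\<bar>C\<bar> * ((\<Sum>i\<le>j. r i) / real j))" by simp
      also have "\<dots> \<le> w j * \<delta>"
        using avg w_pos[of j] by (intro mult_left_mono) auto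
      finally have "r j \<le> w j + (M * (b * w j) * \<rho> + w j * \<delta>)"
        by (subst renewal) simp
      also have "\<dots> = (1 + \<delta> + b * \<rho> * M) * w j" by (simp add: algebra_simps)
      finally show "D j \<le> 1 + \<delta> + b * \<rho> * M" using w_pos[of j] by (simp only: pos_divide_le_eq)
    qed
  qed
  then show ?thesis using eps by blast
qed

text \<open>The window in \<open>upper_step\<close> contains \<open>j\<close> itself, so the
  induction hypothesis only gives \<open>M = max B (D j)\<close>. If \<open>D j\<close> exceeded
  \<open>B\<close>, then \<open>D j \<le> 2 + b * \<rho> * D j\<close>, which the contraction factor
  \<open>b * \<rho> < 1\<close> turns into a contradiction.\<close>

lemma D_bounded: "\<exists>B. \<forall>j. D j \<le> B"
proof -
  \<comment> \<open>A value with both \<open>1 < b\<close> and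
    \<open>b * \<rho> < 1\<close>.\<close>
  define b where "b = 2 / (1 + \<rho>)"
  have b: "1 < b" "b * \<rho> < 1"
    using rho_nonneg rho_less by (auto simp: b_def field_simps)
  obtain \<epsilon> J where J: "\<And>j M. j \<ge> J \<Longrightarrow> (\<And>m. m \<le> j \<Longrightarrow> D m \<le> M) \<Longrightarrow> D j \<le> 1 + 1 + b * \<rho> * M"
    using upper_step[OF b(1), of 1] unfolding eventually_sequentially by (metis zero_less_one)
  \<comment> \<open>\<open>2 / (1 - b * \<rho>)\<close> is the fixed point of the map taking
    \<open>M\<close> to \<open>2 + b * \<rho> * M\<close>; the other entries cover the indices below
    \<open>J\<close>.\<close>
  define B where "B = Max (insert (2 / (1 - b * \<rho>)) (D ` {..<J}))"
  have "D j \<le> B" for j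
  proof (induction j rule: less_induct)
    case (less j)
    show ?case
    proof (cases "j < J")
      case True
      then show ?thesis unfolding B_def by (intro Max_ge) auto
    next
      case False
      have "D m \<le> max B (D j)" if "m \<le> j" for m
        using less[of m] that by (cases "m = j") auto
      then have *: "D j \<le> 1 + 1 + b * \<rho> * max B (D j)"
        using False by (intro J) auto
      show ?thesis
      proof (rule ccontr)
        assume n: "\<not> D j \<le> B"
        then have "D j \<le> 2 + b * \<rho> * D j" using * by (simp add: max_def)
        then have "D j * (1 - b * \<rho>) \<le> 2" unfolding right_diff_distrib by (simp add: mult.commute)
        then have "D j \<le> 2 / (1 - b * \<rho>)" using b by (simp add: pos_le_divide_eq)
        also have "\<dots> \<le> B" unfolding B_def by (intro Max_ge) auto
        finally show False using n by simp
      qed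
    qed
  qed
  then show ?thesis by blast
qed

text \<open>The window of \<open>upper_step\<close> begins at
  \<open>(1 - \<epsilon>) * real j\<close>, which eventually passes any fixed \<open>N\<close>; so a
  bound that holds only eventually may be inserted.\<close>

lemma eventually_upper_step:
  assumes "\<forall>\<^sub>F j in sequentially. D j \<le> M" "1 < b" "0 < \<delta>"
  shows "\<forall>\<^sub>F j in sequentially. D j \<le> 1 + \<delta> + b * \<rho> * M"
proof -
  obtain N where N: "\<And>j. j \<ge> N \<Longrightarrow> D j \<le> M"
    using assms(1) unfolding eventually_sequentially by blast
  obtain \<epsilon> where eps: "\<epsilon> > 0" "\<epsilon> < 1" and step: "\<forall>\<^sub>F j in sequentially. \<forall>M.
     (\<forall>m\<le>j. (1 - \<epsilon>) * real j \<le> real m \<longrightarrow> D m \<le> M) \<longrightarrow> D j \<le> 1 + \<delta> + b * \<rho> * M"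
    using upper_step[OF assms(2,3)] by blast
  have "\<forall>\<^sub>F j in sequentially. real N < (1 - \<epsilon>) * real j"
    using eps by real_asymp
  with step show ?thesis
  proof eventually_elim
    case (elim j)
    then show ?case using N by (metis of_nat_le_iff less_imp_le order.trans)
  qed
qed

text \<open>For a lower bound all but finitely many terms of the convolution may be dropped, and
  monotonicity of \<open>w\<close> suffices for those kept. The loss disappears as \<open>n\<close>
  grows, because the partial sums tend to \<rho>.\<close>

lemma eventually_lower_step:
  assumes "\<forall>\<^sub>F j in sequentially. m \<le> D j" "0 \<le> m"
  shows "\<forall>\<^sub>F j in sequentially. 1 + (\<Sum>i<n. k i) * m \<le> D j"
proof -
  obtain N where N: "\<And>j. j \<ge> N \<Longrightarrow> m \<le> D j"
    using assms(1) unfolding eventually_sequentially by blast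
  have "1 + (\<Sum>i<n. k i) * m \<le> D j" if "j \<ge> N + n" for j
  proof -
    have *: "k i * (m * w j) \<le> k i * r (j - i)" if "i < n" for i
    proof -
      have "m * w j \<le> m * w (j - i)"
        using assms by (intro mult_left_mono w_dec) auto
      also have "\<dots> \<le> r (j - i)"
        using N[of "j - i"] that \<open>j \<ge> N + n\<close> w_pos[of "j - i"] by (simp add: pos_le_divide_eq)
      finally show ?thesis by (intro mult_left_mono k_nonneg)
    qed
    have "(1 + (\<Sum>i<n. k i) * m) * w j = w j + (\<Sum>i<n. k i * (m * w j))"
      by (simp add: algebra_simps sum_distrib_left)
    also have "(\<Sum>i<n. k i * (m * w j)) \<le> (\<Sum>i<n. k i * r (j - i))"
      by (intro sum_mono *) auto
    also have "\<dots> \<le> (\<Sum>i\<le>j. k i * r (j - i))"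
      using that k_nonneg r_nonneg by (intro sum_mono2) auto
    finally have "(1 + (\<Sum>i<n. k i) * m) * w j \<le> w j + (\<Sum>i\<le>j. k i * r (j - i))" by simp
    then have "(1 + (\<Sum>i<n. k i) * m) * w j \<le> r j" using renewal[of j] by simp
    then show ?thesis
      using w_pos[of j] by (simp only: pos_le_divide_eq)
  qed
  then show ?thesis unfolding eventually_sequentially by blast
qed

text \<open>\<open>Inf U\<close> and \<open>Sup E\<close> are the upper and lower limits of
  \<open>D\<close>, taken as real numbers thanks to \<open>D_bounded\<close>. Both steps iterate the
  map from \<open>x\<close> to \<open>1 + \<rho> * x\<close>, whose fixed point is
  \<open>1 / (1 - \<rho>)\<close>, and give
  \<open>Inf U \<le> 1 / (1 - \<rho>) \<le> Sup E\<close>.\<close>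

lemma D_tendsto: "D \<longlonglongrightarrow> 1 / (1 - \<rho>)"
proof (rule order_tendstoI)
  obtain B where B: "\<And>j. D j \<le> B" using D_bounded by blast
  define U where "U = {M. \<forall>\<^sub>F j in sequentially. D j \<le> M}"
  define E where "E = {m. 0 \<le> m \<and> (\<forall>\<^sub>F j in sequentially. m \<le> D j)}"
  have U: "U \<noteq> {}" "bdd_below U"
  proof -
    have "B \<in> U" using B by (simp add: U_def)
    then show "U \<noteq> {}" by blast
    have "0 \<le> M" if M: "M \<in> U" for M
    proof -
      obtain j where "D j \<le> M" using M unfolding U_def eventually_sequentially by blast
      then show ?thesis using D_nonneg order_trans by blast
    qed
    then show "bdd_below U" by (auto simp: bdd_below_def)
  qed
  have E: "E \<noteq> {}" "bdd_above E"
  proof -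
    have "0 \<in> E" using D_nonneg by (simp add: E_def)
    then show "E \<noteq> {}" by blast
    have "m \<le> B" if m: "m \<in> E" for m
    proof -
      obtain j where "m \<le> D j" using m unfolding E_def eventually_sequentially by blast
      then show ?thesis using B order_trans by blast
    qed
    then show "bdd_above E" by (auto simp: bdd_above_def)
  qed
  \<comment> \<open>Both losses of the upper step, \<open>b - 1\<close> and \<open>\<delta>\<close>,
    are set to \<open>1 / real (Suc n)\<close> and sent to 0.\<close>
  have "Inf U \<le> 1 + \<rho> * M" if "M \<in> U" for M
  proof (rule LIMSEQ_le_const)
    show "(\<lambda>n. 1 + 1 / real (Suc n) + (1 + 1 / real (Suc n)) * \<rho> * M) \<longlonglongrightarrow> 1 + \<rho> * M"
      by real_asymp
    have "Inf U \<le> 1 + 1 / real (Suc n) + (1 + 1 / real (Suc n)) * \<rho> * M" for n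
      using eventually_upper_step[of M "1 + 1 / real (Suc n)" "1 / real (Suc n)"] that U
      by (intro cInf_lower) (auto simp: U_def)
    then show "\<exists>N. \<forall>n\<ge>N. Inf U \<le> 1 + 1 / real (Suc n) + (1 + 1 / real (Suc n)) * \<rho> * M" by blast
  qed
  note step = this
  have "Inf U \<le> 1 + \<rho> * Inf U"
  \<comment> \<open>To pass to the infimum over \<open>M\<close> the affine bound is solved for
    \<open>M\<close>, which divides by \<rho>.\<close>
  proof (cases "\<rho> = 0")
    case True
    then show ?thesis using step U by auto
  next
    case False
    then have "0 < \<rho>" using rho_nonneg by simp
    then have "(Inf U - 1) / \<rho> \<le> M" if "M \<in> U" for M
      using step[OF that] by (simp add: pos_divide_le_eq algebra_simps)
    then have "(Inf U - 1) / \<rho> \<le> Inf U" by (intro cInf_greatest U)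
    then show ?thesis using \<open>0 < \<rho>\<close> by (simp add: pos_divide_le_eq algebra_simps)
  qed
  then have upper: "Inf U \<le> 1 / (1 - \<rho>)"
    using rho_less by (simp add: pos_le_divide_eq algebra_simps)
  have "1 + \<rho> * m \<le> Sup E" if "m \<in> E" for m
  proof (rule LIMSEQ_le_const2)
    have "(\<lambda>n. \<Sum>i<n. k i) \<longlonglongrightarrow> \<rho>" using k_sums by (simp add: sums_def)
    then show "(\<lambda>n. 1 + (\<Sum>i<n. k i) * m) \<longlonglongrightarrow> 1 + \<rho> * m" by (intro tendsto_intros)
    have "1 + (\<Sum>i<n. k i) * m \<le> Sup E" for n
      using eventually_lower_step[of m n] that E k_nonneg
      by (intro cSup_upper) (auto simp: E_def sum_nonneg add_nonneg_nonneg)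
    then show "\<exists>N. \<forall>n\<ge>N. 1 + (\<Sum>i<n. k i) * m \<le> Sup E" by blast
  qed
  note step = this
  have "1 + \<rho> * Sup E \<le> Sup E"
  proof (cases "\<rho> = 0")
    case True
    then show ?thesis using step E by auto
  next
    case False
    then have "0 < \<rho>" using rho_nonneg by simp
    then have "m \<le> (Sup E - 1) / \<rho>" if "m \<in> E" for m
      using step[OF that] by (simp add: pos_le_divide_eq algebra_simps)
    then have "Sup E \<le> (Sup E - 1) / \<rho>" by (intro cSup_least E)
    then show ?thesis using \<open>0 < \<rho>\<close> by (simp add: pos_le_divide_eq algebra_simps)
  qed
  then have lower: "1 / (1 - \<rho>) \<le> Sup E"
    using rho_less by (simp add: pos_divide_le_eq algebra_simps)
  show "\<forall>\<^sub>F j in sequentially. D j < u" if u: "1 / (1 - \<rho>) < u" for u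
  proof -
    obtain M where "M \<in> U" "M < u" using cInf_lessD[OF U(1)] order.strict_trans1[OF upper u] by blast
    then show ?thesis by (auto simp: U_def elim!: eventually_mono)
  qed
  show "\<forall>\<^sub>F j in sequentially. l < D j" if l: "l < 1 / (1 - \<rho>)" for l
  proof -
    obtain m where "m \<in> E" "l < m" using less_cSupD[OF E(1)] order.strict_trans2[OF l lower] by blast
    then show ?thesis by (auto simp: E_def elim!: eventually_mono)
  qed
qed

end

section \<open>Poisson arrivals during a service\<close>

text \<open>The probability that a Poisson variable of mean \<open>y\<close> is strictly larger than
  \<open>n\<close>. As a formula it makes sense for every real \<open>y\<close>, hence the sign
  conditions in the bounds.\<close>

definition poisson_tail :: "nat \<Rightarrow> real \<Rightarrow> real" where
  "poisson_tail n y = 1 - exp (- y) * (\<Sum>k\<le>n. y ^ k / fact k)"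

lemma exp_partial_sum_le:
  assumes "0 \<le> (y::real)"
  shows "(\<Sum>k\<le>n. y ^ k / fact k) \<le> exp y"
proof -
  have "(\<lambda>k. y ^ k / fact k) sums exp y"
    using exp_converges[of y] by (simp add: scaleR_conv_of_real field_simps)
  then show ?thesis
    using sum_le_suminf[of "\<lambda>k. y ^ k / fact k" "{..n}"] assms by (simp add: sums_iff)
qed

lemma poisson_tail_bounds:
  assumes "0 \<le> y"
  shows "0 \<le> poisson_tail n y" "poisson_tail n y \<le> 1"
proof -
  have "exp (- y) * (\<Sum>k\<le>n. y ^ k / fact k) \<le> exp (- y) * exp y"
    by (intro mult_left_mono exp_partial_sum_le assms) auto
  then show "0 \<le> poisson_tail n y"
    by (simp add: poisson_tail_def flip: exp_add)
  show "poisson_tail n y \<le> 1"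
    using assms by (simp add: poisson_tail_def sum_nonneg)
qed

text \<open>More than \<open>n\<close> arrivals by time \<open>y\<close> means that arrival number
  \<open>n + 1\<close> has occurred, so the derivative is an Erlang density. In the induction the
  product rule yields the previous density with opposite sign. The purpose is monotonicity in
  \<open>y\<close>.\<close>

lemma poisson_tail_deriv:
  "(poisson_tail n has_real_derivative exp (- y) * y ^ n / fact n) (at y)"
proof (induction n)
  case 0
  show ?case unfolding poisson_tail_def
    by (auto intro!: derivative_eq_intros)
next
  case (Suc n)
  have eq: "poisson_tail (Suc n) = (\<lambda>y. poisson_tail n y - exp (- y) * (y ^ Suc n / fact (Suc n)))"
    by (auto simp: poisson_tail_def fun_eq_iff algebra_simps)
  have "((\<lambda>y. y ^ Suc n / fact (Suc n)) has_real_derivative real (Suc n) * y ^ n / fact (Suc n)) (at y)"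
    by (rule DERIV_cdivide) (use DERIV_pow[of "Suc n" y] in simp)
  also have "real (Suc n) * y ^ n / fact (Suc n) = y ^ n / fact n"
    by (simp del: of_nat_Suc)
  finally have P: "((\<lambda>y. y ^ Suc n / fact (Suc n)) has_real_derivative y ^ n / fact n) (at y)" .
  have E: "((\<lambda>y::real. exp (- y)) has_real_derivative - exp (- y)) (at y)"
    by (auto intro!: derivative_eq_intros)
  have "(poisson_tail (Suc n) has_real_derivative exp (- y) * y ^ n / fact n
      - (- exp (- y) * (y ^ Suc n / fact (Suc n)) + y ^ n / fact n * exp (- y))) (at y)"
    unfolding eq by (rule DERIV_diff[OF Suc DERIV_mult[OF E P]])
  then show ?case by (simp add: mult.commute)
qed

lemma poisson_tail_mono:
  assumes "0 \<le> x" "x \<le> y"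
  shows "poisson_tail n x \<le> poisson_tail n y"
proof (rule DERIV_nonneg_imp_nondecreasing[OF assms(2)])
  fix z assume "x \<le> z" "z \<le> y"
  then show "\<exists>d. (poisson_tail n has_real_derivative d) (at z) \<and> 0 \<le> d"
    using assms by (intro exI[of _ "exp (- z) * z ^ n / fact n"] conjI poisson_tail_deriv) auto
qed

lemma borel_measurable_poisson_tail [measurable]: "poisson_tail n \<in> borel_measurable borel"
  unfolding poisson_tail_def by measurable

text \<open>On the indices beyond \<open>n\<close> the weight \<open>u ^ n\<close> is at most
  \<open>u ^ k\<close>, so the remainder of the series of \<open>exp y\<close>, multiplied by
  \<open>u ^ n\<close>, is dominated by the series of \<open>exp (u * y)\<close>.\<close>

lemma poisson_tail_le_chernoff:
  assumes "0 \<le> y" "1 \<le> u"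
  shows "poisson_tail n y \<le> exp (u * y - y) / u ^ n"
proof -
  have S: "(\<lambda>k. x ^ (k + Suc n) / fact (k + Suc n)) sums (exp x - (\<Sum>k\<le>n. x ^ k / fact k))" for x :: real
  proof -
    have "(\<lambda>k. x ^ k / fact k) sums exp x"
      using exp_converges[of x] by (simp add: scaleR_conv_of_real field_simps)
    from sums_split_initial_segment[OF this, of "Suc n"] show ?thesis
      by (simp add: lessThan_Suc_atMost)
  qed
  have "u ^ n * (exp y - (\<Sum>k\<le>n. y ^ k / fact k)) \<le> exp (u * y) - (\<Sum>k\<le>n. (u * y) ^ k / fact k)"
  proof (rule sums_le[OF _ sums_mult[OF S] S])
    fix k
    have "u ^ n \<le> u ^ (k + Suc n)" using assms by (intro power_increasing) auto
    then have "u ^ n * (y ^ (k + Suc n) / fact (k + Suc n)) \<le> u ^ (k + Suc n) * (y ^ (k + Suc n) / fact (k + Suc n))"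
      using assms by (intro mult_right_mono) auto
    then show "u ^ n * (y ^ (k + Suc n) / fact (k + Suc n)) \<le> (u * y) ^ (k + Suc n) / fact (k + Suc n)"
      by (simp only: power_mult_distrib times_divide_eq_right)
  qed
  also have "\<dots> \<le> exp (u * y)" using assms by (simp add: sum_nonneg)
  finally have "exp y - (\<Sum>k\<le>n. y ^ k / fact k) \<le> exp (u * y) / u ^ n"
    using assms by (simp add: pos_le_divide_eq mult.commute)
  then have "exp (- y) * (exp y - (\<Sum>k\<le>n. y ^ k / fact k)) \<le> exp (- y) * (exp (u * y) / u ^ n)"
    by (intro mult_left_mono) auto
  moreover have "exp (- y) * (exp y - (\<Sum>k\<le>n. y ^ k / fact k)) = poisson_tail n y"
    by (simp add: poisson_tail_def right_diff_distrib flip: exp_add)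
  moreover have "exp (- y) * (exp (u * y) / u ^ n) = exp (u * y - y) / u ^ n"
    by (simp add: add.commute flip: exp_add)
  ultimately show ?thesis by argo
qed

text \<open>For \<open>u \<le> 1\<close> the comparison of \<open>u ^ n\<close> with
  \<open>u ^ k\<close> holds on the indices up to \<open>n\<close>, and it bounds the complementary
  probability.\<close>

lemma poisson_tail_ge_chernoff:
  assumes "0 \<le> y" "0 < u" "u \<le> 1"
  shows "1 - exp (u * y - y) / u ^ n \<le> poisson_tail n y"
proof -
  have "u ^ n * (\<Sum>k\<le>n. y ^ k / fact k) \<le> (\<Sum>k\<le>n. (u * y) ^ k / fact k)"
    unfolding sum_distrib_left
  proof (intro sum_mono)
    fix k assume "k \<in> {..n}"
    then have "u ^ n \<le> u ^ k" using assms by (intro power_decreasing) auto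
    then have "u ^ n * (y ^ k / fact k) \<le> u ^ k * (y ^ k / fact k)"
      using assms by (intro mult_right_mono) auto
    then show "u ^ n * (y ^ k / fact k) \<le> (u * y) ^ k / fact k" by (simp add: power_mult_distrib)
  qed
  also have "\<dots> \<le> exp (u * y)" using assms by (intro exp_partial_sum_le) auto
  finally have "(\<Sum>k\<le>n. y ^ k / fact k) \<le> exp (u * y) / u ^ n"
    using assms by (simp add: pos_le_divide_eq mult.commute)
  then have "exp (- y) * (\<Sum>k\<le>n. y ^ k / fact k) \<le> exp (- y) * (exp (u * y) / u ^ n)"
    by (intro mult_left_mono) auto
  then show ?thesis by (simp add: poisson_tail_def exp_diff exp_minus field_simps)
qed

text \<open>The Cauchy product of the Poisson weights with the geometric series generates the
  distribution function; subtracting it from the geometric series gives the tail.\<close>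

lemma poisson_tail_generating_function:
  assumes "0 \<le> z" "z < 1"
  shows "(\<lambda>n. z ^ n * poisson_tail n y) sums ((1 - exp (- (y * (1 - z)))) / (1 - z))"
proof -
  let ?p = "\<lambda>k. exp (- y) * ((z * y) ^ k / fact k)"
  have p: "?p sums (exp (- y) * exp (z * y))"
    using exp_converges[of "z * y"] by (intro sums_mult) (simp add: scaleR_conv_of_real field_simps)
  have geo: "(\<lambda>n. z ^ n) sums (1 / (1 - z))" using assms by (intro geometric_sums) auto
  have "(\<lambda>n. \<Sum>i\<le>n. ?p i * z ^ (n - i)) sums ((\<Sum>k. ?p k) * (\<Sum>k. z ^ k))"
  proof (rule Cauchy_product_sums)
    have "summable (\<lambda>k. norm ((z * y) ^ k / fact k))"
      using summable_norm_exp[of "z * y"] by (simp add: field_simps)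
    then show "summable (\<lambda>k. norm (?p k))" unfolding norm_mult by (rule summable_mult)
    show "summable (\<lambda>k. norm (z ^ k))" using assms by (simp add: summable_geometric power_abs)
  qed
  also have "(\<lambda>n. \<Sum>i\<le>n. ?p i * z ^ (n - i)) = (\<lambda>n. z ^ n * (exp (- y) * (\<Sum>k\<le>n. y ^ k / fact k)))"
  proof
    fix n
    have "?p i * z ^ (n - i) = z ^ n * (exp (- y) * (y ^ i / fact i))" if "i \<le> n" for i
    proof -
      have "z ^ n = z ^ i * z ^ (n - i)" using that by (simp flip: power_add)
      then show ?thesis by (simp add: power_mult_distrib)
    qed
    then have "(\<Sum>i\<le>n. ?p i * z ^ (n - i)) = (\<Sum>i\<le>n. z ^ n * (exp (- y) * (y ^ i / fact i)))"
      by (intro sum.cong) auto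
    then show "(\<Sum>i\<le>n. ?p i * z ^ (n - i)) = z ^ n * (exp (- y) * (\<Sum>k\<le>n. y ^ k / fact k))"
      by (simp add: sum_distrib_left)
  qed
  also have "(\<Sum>k. ?p k) * (\<Sum>k. z ^ k) = exp (- y) * exp (z * y) * (1 / (1 - z))"
    using p geo by (simp add: sums_iff)
  finally have "(\<lambda>n. z ^ n - z ^ n * (exp (- y) * (\<Sum>k\<le>n. y ^ k / fact k)))
      sums (1 / (1 - z) - exp (- y) * exp (z * y) * (1 / (1 - z)))"
    by (intro sums_diff geo)
  moreover have "1 / (1 - z) - exp (- y) * exp (z * y) * (1 / (1 - z)) = (1 - exp (- (y * (1 - z)))) / (1 - z)"
    by (simp add: algebra_simps diff_divide_distrib flip: exp_add)
  ultimately show ?thesis by (simp add: poisson_tail_def right_diff_distrib)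
qed

text \<open>These numbers are the Chernoff rates for means \<open>(1 - e) * n\<close> and
  \<open>(1 + e) * n\<close>. Strict inequality is essential and comes from squaring the linear
  bound on the exponential at half the argument, which leaves the term
  \<open>e\<^sup>2 / 4\<close>.\<close>

lemma one_minus_less_exp_minus:
  assumes "0 < e" "e < (1::real)"
  shows "(1 - e) * exp e < 1" "(1 + e) * exp (- e) < 1"
proof -
  have "1 + e < (1 + e / 2)\<^sup>2" using assms by (simp add: power2_eq_square algebra_simps)
  also have "\<dots> \<le> (exp (e / 2))\<^sup>2" using assms exp_ge_add_one_self[of "e / 2"] by (intro power_mono) auto
  also have "\<dots> = exp e" by (simp flip: exp_of_nat_mult)
  finally show "(1 + e) * exp (- e) < 1" by (simp add: exp_minus field_simps)
  have "1 - e < (1 - e / 2)\<^sup>2" using assms by (simp add: power2_eq_square algebra_simps)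
  also have "\<dots> \<le> (exp (- e / 2))\<^sup>2" using assms exp_ge_add_one_self[of "- e / 2"] by (intro power_mono) auto
  also have "\<dots> = exp (- e)" by (simp flip: exp_of_nat_mult)
  finally show "(1 - e) * exp e < 1" by (simp add: exp_minus field_simps)
qed

text \<open>Sum and integral are interchanged with the geometric series as majorant. It serves both
  the Poisson tails mixed over the service law and the indicators of the queue length.\<close>

lemma (in prob_space) sums_integral_power_series:
  fixes F :: "nat \<Rightarrow> 'a \<Rightarrow> real"
  assumes [measurable]: "\<And>n. F n \<in> borel_measurable M" "G \<in> borel_measurable M"
    and bnd: "AE x in M. \<forall>n. \<bar>F n x\<bar> \<le> 1"
    and z: "0 \<le> z" "z < 1"
    and sums: "AE x in M. (\<lambda>n. z ^ n * F n x) sums G x"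
  shows "(\<lambda>n. z ^ n * (\<integral>x. F n x \<partial>M)) sums (\<integral>x. G x \<partial>M)"
proof -
  have geo: "summable (\<lambda>n. z ^ n)" using z by (simp add: summable_geometric)
  have le: "\<bar>z ^ n * F n x\<bar> \<le> z ^ n" if "\<forall>n. \<bar>F n x\<bar> \<le> 1" for n x
    using that z by (simp add: abs_mult mult_left_le power_abs)
  have int: "integrable M (\<lambda>x. z ^ n * F n x)" for n
    by (rule integrable_const_bound[where B="z ^ n"]) (use bnd le in auto)
  have "(\<lambda>n. \<integral>x. z ^ n * F n x \<partial>M) sums (\<integral>x. (\<Sum>n. z ^ n * F n x) \<partial>M)"
  proof (rule sums_integral[OF int])
    show "AE x in M. summable (\<lambda>n. norm (z ^ n * F n x))"
      using bnd
    proof eventually_elim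
      case (elim x)
      show ?case by (rule summable_comparison_test'[OF geo]) (use le[OF elim] in auto)
    qed
    show "summable (\<lambda>n. \<integral>x. norm (z ^ n * F n x) \<partial>M)"
    proof (rule summable_comparison_test'[OF geo])
      fix n :: nat
      have "(\<integral>x. norm (z ^ n * F n x) \<partial>M) \<le> (\<integral>x. z ^ n \<partial>M)"
        by (rule integral_mono_AE) (use int bnd le in auto)
      then show "norm (\<integral>x. norm (z ^ n * F n x) \<partial>M) \<le> z ^ n"
        by (simp add: prob_space)
    qed
  qed
  also have "(\<integral>x. (\<Sum>n. z ^ n * F n x) \<partial>M) = (\<integral>x. G x \<partial>M)"
    by (rule integral_cong_AE) (use sums in \<open>auto simp: sums_iff\<close>)
  finally show ?thesis by simp
qed

text \<open>Given a service time \<open>x\<close>, the number of Poisson arrivals of rate \<open>c\<close> during the service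
  exceeds \<open>n\<close> with probability \<open>poisson_tail n (c * x)\<close>.\<close>

definition mixed_tail :: "real measure \<Rightarrow> real \<Rightarrow> nat \<Rightarrow> real" where
  "mixed_tail S c n = (\<integral>x. poisson_tail n (c * x) \<partial>S)"

locale service_law = real_distribution S for S +
  fixes c :: real
  assumes AE_pos: "AE x in S. 0 < x" and c_pos: "0 < c"
begin

lemma prob_UNIV: "prob UNIV = 1"
  using prob_space by simp

lemma AE_tail_bounded: "AE x in S. \<forall>n. \<bar>poisson_tail n (c * x)\<bar> \<le> 1"
  using AE_pos
proof eventually_elim
  case (elim x)
  then have "0 \<le> c * x" using c_pos by simp
  then show ?case using poisson_tail_bounds by simp
qed

lemma integrable_tail: "integrable S (\<lambda>x. poisson_tail n (c * x))"
  by (rule integrable_const_bound[where B=1]) (use AE_tail_bounded in auto)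

lemma mixed_tail_nonneg: "0 \<le> mixed_tail S c n"
  unfolding mixed_tail_def
  by (rule integral_nonneg_AE) (use AE_pos c_pos poisson_tail_bounds in auto)

lemma mixed_tail_generating_function:
  assumes "0 \<le> z" "z < 1"
  shows "(\<lambda>n. z ^ n * mixed_tail S c n) sums ((1 - LST S (c * (1 - z))) / (1 - z))"
proof -
  have "(\<lambda>n. z ^ n * mixed_tail S c n) sums (\<integral>x. (1 - exp (- (c * x * (1 - z)))) / (1 - z) \<partial>S)"
    unfolding mixed_tail_def
    by (rule sums_integral_power_series)
      (use assms AE_tail_bounded poisson_tail_generating_function in auto)
  also have "(\<integral>x. (1 - exp (- (c * x * (1 - z)))) / (1 - z) \<partial>S) = (1 - LST S (c * (1 - z))) / (1 - z)"
  proof -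
    have "integrable S (\<lambda>x. exp (- (c * x * (1 - z))))"
      by (rule integrable_const_bound[where B=1]) (use AE_pos c_pos assms in auto)
    then show ?thesis by (simp add: LST_def prob_UNIV mult_ac)
  qed
  finally show ?thesis .
qed

text \<open>Services longer than \<open>y / c\<close> are counted in full; the shorter ones have
  Poisson mean at most \<open>y\<close>, and the tail is monotone in the mean.\<close>

lemma mixed_tail_le:
  assumes "0 \<le> y"
  shows "mixed_tail S c n \<le> measure S {y / c <..} + poisson_tail n y"
proof -
  have "mixed_tail S c n \<le> (\<integral>x. indicator {y / c <..} x + poisson_tail n y \<partial>S)"
    unfolding mixed_tail_def
  proof (rule integral_mono_AE[OF integrable_tail])
    show "AE x in S. poisson_tail n (c * x) \<le> indicator {y / c <..} x + poisson_tail n y"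
      using AE_pos
    proof eventually_elim
      case (elim x)
      then have cx: "0 < c * x" using c_pos by simp
      show ?case
      proof (cases "y / c < x")
        case True
        then show ?thesis
          using poisson_tail_bounds(2)[of "c * x" n] poisson_tail_bounds(1)[OF assms, of n] cx by simp
      next
        case False
        then have "c * x \<le> y" using c_pos by (simp add: field_simps)
        then show ?thesis using poisson_tail_mono[of "c * x" y n] cx False by simp
      qed
    qed
  qed (auto simp: less_top[symmetric])
  also have "\<dots> = measure S {y / c <..} + poisson_tail n y"
    by (simp add: prob_UNIV less_top[symmetric])
  finally show ?thesis .
qed

lemma mixed_tail_ge:
  assumes "0 \<le> y"
  shows "measure S {y / c <..} * poisson_tail n y \<le> mixed_tail S c n"
proof -
  have "measure S {y / c <..} * poisson_tail n y = (\<integral>x. indicator {y / c <..} x * poisson_tail n y \<partial>S)"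
    by simp
  also have "\<dots> \<le> mixed_tail S c n"
    unfolding mixed_tail_def
  proof (rule integral_mono_AE[OF _ integrable_tail])
    show "AE x in S. indicator {y / c <..} x * poisson_tail n y \<le> poisson_tail n (c * x)"
      using AE_pos
    proof eventually_elim
      case (elim x)
      then have cx: "0 < c * x" using c_pos by simp
      show ?case
      proof (cases "y / c < x")
        case True
        then have "y \<le> c * x" using c_pos by (simp add: field_simps)
        then show ?thesis using poisson_tail_mono[OF assms] True by simp
      qed (use poisson_tail_bounds(1) cx in auto)
    qed
  qed (auto simp: less_top[symmetric])
  finally show ?thesis .
qed

end

section \<open>Poisson mixing preserves a regularly varying tail\<close>

locale regvar_service = service_law S c + monotone_regvar "\<lambda>t. measure S {t / c <..}" a
  for S c a +
  assumes a_gt_1: "1 < a"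
begin

text \<open>The tail of \<open>c\<close> times the service time, that is, of the expected number of
  arrivals given the service time; in this scale \<open>mixed_tail S c n\<close> is compared with
  \<open>f (real n)\<close> without further constants.\<close>

abbreviation f :: "real \<Rightarrow> real" where "f t \<equiv> measure S {t / c <..}"

text \<open>The service times are cut where the Poisson mean is \<open>(1 - e) * n\<close> or
  \<open>(1 + e) * n\<close>. The Poisson error is then exponentially small, while moving the cut
  changes \<open>f\<close> only by the factor \<open>(1 - e) powr - a\<close> or
  \<open>(1 + e) powr - a\<close>, close to 1 for small \<open>e\<close>.\<close>

lemma mixed_tail_equiv: "(\<lambda>n. mixed_tail S c n / f (real n)) \<longlonglongrightarrow> 1"
proof (rule order_tendstoI)
  fix u :: real assume u: "1 < u"
  have "((\<lambda>e. (1 - e) powr - a) \<longlongrightarrow> (1 - 0) powr - a) (at_right 0)"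
    by (intro tendsto_intros) auto
  then have "\<forall>\<^sub>F e in at_right 0. (1 - e) powr - a < u"
    using u by (intro order_tendstoD) auto
  moreover have "\<forall>\<^sub>F e in at_right (0::real). e \<in> {0<..<1}"
    by (rule eventually_at_right_real) simp
  ultimately have "\<exists>e. (1 - e) powr - a < u \<and> e \<in> {0<..<1}"
    by (intro eventually_happens'[OF trivial_limit_at_right_real] eventually_conj)
  then obtain e where e: "(1 - e) powr - a < u" "0 < e" "e < 1" by auto
  have up: "mixed_tail S c n \<le> f ((1 - e) * real n) + ((1 - e) * exp e) ^ n" for n
  proof -
    \<comment> \<open>The Chernoff parameter is the optimal one, \<open>n\<close> divided by the
      mean.\<close>
    have "poisson_tail n ((1 - e) * real n)
        \<le> exp (1 / (1 - e) * ((1 - e) * real n) - (1 - e) * real n) / (1 / (1 - e)) ^ n"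
      using e by (intro poisson_tail_le_chernoff) auto
    also have "1 / (1 - e) * ((1 - e) * real n) = real n"
      using e by simp
    also have "real n - (1 - e) * real n = real n * e"
      by (simp add: algebra_simps)
    also have "exp (real n * e) / (1 / (1 - e)) ^ n = ((1 - e) * exp e) ^ n"
      using exp_of_nat_mult[of n e] by (simp add: power_divide power_mult_distrib)
    finally show ?thesis using mixed_tail_le[of "(1 - e) * real n" n] e by simp
  qed
  have lim: "(\<lambda>n. f ((1 - e) * real n) / f (real n) + ((1 - e) * exp e) ^ n / f (real n))
      \<longlonglongrightarrow> (1 - e) powr - a + 0"
  proof (intro tendsto_add)
    show "(\<lambda>n. f ((1 - e) * real n) / f (real n)) \<longlonglongrightarrow> (1 - e) powr - a"
      by (rule filterlim_compose[OF ratio filterlim_real_sequentially]) (use e in auto)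
    show "(\<lambda>n. ((1 - e) * exp e) ^ n / f (real n)) \<longlonglongrightarrow> 0"
      using e a_gt_1 one_minus_less_exp_minus[of e] by (intro power_over_f_tendsto_zero) auto
  qed
  then have "\<forall>\<^sub>F n in sequentially. f ((1 - e) * real n) / f (real n) + ((1 - e) * exp e) ^ n / f (real n) < u"
    using e by (intro order_tendstoD[OF lim]) auto
  then show "\<forall>\<^sub>F n in sequentially. mixed_tail S c n / f (real n) < u"
  proof eventually_elim
    case (elim n)
    have "mixed_tail S c n / f (real n) \<le> (f ((1 - e) * real n) + ((1 - e) * exp e) ^ n) / f (real n)"
      using up pos by (intro divide_right_mono) (auto intro: less_imp_le)
    then show ?case using elim by (simp add: add_divide_distrib)
  qed
next
  fix l :: real assume l: "l < 1"
  have "((\<lambda>e. (1 + e) powr - a) \<longlongrightarrow> (1 + 0) powr - a) (at_right 0)"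
    by (intro tendsto_intros) auto
  then have "\<forall>\<^sub>F e in at_right 0. l < (1 + e) powr - a"
    using l by (intro order_tendstoD) auto
  moreover have "\<forall>\<^sub>F e in at_right (0::real). e \<in> {0<..<1}"
    by (rule eventually_at_right_real) simp
  ultimately have "\<exists>e. l < (1 + e) powr - a \<and> e \<in> {0<..<1}"
    by (intro eventually_happens'[OF trivial_limit_at_right_real] eventually_conj)
  then obtain e where e: "l < (1 + e) powr - a" "0 < e" "e < 1" by auto
  let ?r = "(1 + e) * exp (- e)"
  have r: "0 < ?r" "?r < 1" using one_minus_less_exp_minus[of e] e by auto
  have low: "f ((1 + e) * real n) * (1 - ?r ^ n) \<le> mixed_tail S c n" for n
  proof -
    have "1 - exp (1 / (1 + e) * ((1 + e) * real n) - (1 + e) * real n) / (1 / (1 + e)) ^ n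
        \<le> poisson_tail n ((1 + e) * real n)"
      using e by (intro poisson_tail_ge_chernoff) auto
    also have "1 / (1 + e) * ((1 + e) * real n) = real n"
      using e by simp
    also have "real n - (1 + e) * real n = real n * - e"
      by (simp add: algebra_simps)
    also have "exp (real n * - e) / (1 / (1 + e)) ^ n = ?r ^ n"
      using exp_of_nat_mult[of n "- e"] by (simp add: power_divide power_mult_distrib)
    finally have "f ((1 + e) * real n) * (1 - ?r ^ n) \<le> f ((1 + e) * real n) * poisson_tail n ((1 + e) * real n)"
      by (intro mult_left_mono) auto
    then show ?thesis using mixed_tail_ge[of "(1 + e) * real n" n] e by simp
  qed
  have lim: "(\<lambda>n. f ((1 + e) * real n) / f (real n) * (1 - ?r ^ n)) \<longlonglongrightarrow> (1 + e) powr - a * (1 - 0)"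
  proof (intro tendsto_mult tendsto_diff tendsto_const)
    show "(\<lambda>n. f ((1 + e) * real n) / f (real n)) \<longlonglongrightarrow> (1 + e) powr - a"
      by (rule filterlim_compose[OF ratio filterlim_real_sequentially]) (use e in auto)
    show "(\<lambda>n. ?r ^ n) \<longlonglongrightarrow> 0" using r by (intro LIMSEQ_power_zero) auto
  qed
  then have "\<forall>\<^sub>F n in sequentially. l < f ((1 + e) * real n) / f (real n) * (1 - ?r ^ n)"
    using e by (intro order_tendstoD[OF lim]) auto
  then show "\<forall>\<^sub>F n in sequentially. l < mixed_tail S c n / f (real n)"
  proof eventually_elim
    case (elim n)
    have "f ((1 + e) * real n) / f (real n) * (1 - ?r ^ n) \<le> mixed_tail S c n / f (real n)"
      unfolding times_divide_eq_left by (intro divide_right_mono low) simp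
    with elim show ?case by (rule order.strict_trans2)
  qed
qed

end

section \<open>Geometric compound sums\<close>

text \<open>Identity of power series from values on \<open>(0, 1)\<close> only, since the generating
  functions are known there. Once the coefficients below \<open>m\<close> vanish, dividing by
  \<open>z ^ m\<close> and letting \<open>z\<close> decrease to 0 isolates
  \<open>A m\<close>.\<close>

lemma power_series_eq_0:
  fixes A :: "nat \<Rightarrow> real"
  assumes "\<And>z. 0 < z \<Longrightarrow> z < 1 \<Longrightarrow> (\<lambda>n. z ^ n * A n) sums 0"
  shows "A m = 0"
proof (induction m rule: less_induct)
  case (less m)
  define B where "B n = A (n + m)" for n
  have B: "(\<lambda>n. B n * z ^ n) sums 0" if z: "0 < z" "z < 1" for z
  proof -
    have "(\<Sum>n<m. z ^ n * A n) = 0" using less by simp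
    then have "(\<lambda>n. z ^ (n + m) * A (n + m)) sums 0"
      using sums_split_initial_segment[OF assms[OF z], of m] by simp
    from sums_mult[OF this, of "1 / z ^ m"] show ?thesis
      using z by (simp add: B_def power_add mult_ac)
  qed
  have "summable (\<lambda>n. B n * x ^ n)" if "norm x < 1 / 2" for x
    by (rule powser_inside[of B "1 / 2"]) (use B[of "1 / 2"] that in \<open>auto simp: sums_iff\<close>)
  then have "((\<lambda>x. \<Sum>n. B n * x ^ n) \<longlongrightarrow> B 0) (at 0)"
    by (intro powser_limit_0[of "1 / 2"]) (auto simp: summable_sums)
  then have "((\<lambda>x. \<Sum>n. B n * x ^ n) \<longlongrightarrow> B 0) (at_right 0)"
    by (rule tendsto_within_subset) simp
  moreover have "\<forall>\<^sub>F x in at_right (0::real). x \<in> {0<..<1}"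
    by (rule eventually_at_right_real) simp
  then have "\<forall>\<^sub>F x in at_right 0. (\<Sum>n. B n * x ^ n) = 0"
    by eventually_elim (use B in \<open>auto simp: sums_iff\<close>)
  then have "((\<lambda>x. \<Sum>n. B n * x ^ n) \<longlongrightarrow> 0) (at_right 0)"
    by (rule tendsto_eventually)
  ultimately have "B 0 = 0"
    by (rule tendsto_unique[OF trivial_limit_at_right_real])
  then show ?case by (simp add: B_def)
qed

lemma power_series_partial_sums:
  fixes g :: "nat \<Rightarrow> real"
  assumes g: "(\<lambda>n. z ^ n * g n) sums k" and pos: "\<And>n. 0 \<le> g n" and z: "0 \<le> z" "z < 1"
  shows "(\<lambda>n. z ^ n * (\<Sum>i\<le>n. g i)) sums (k / (1 - z))"
proof -
  have "(\<lambda>n. \<Sum>i\<le>n. (z ^ i * g i) * z ^ (n - i)) sums ((\<Sum>n. z ^ n * g n) * (\<Sum>n. z ^ n))"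
    using g pos z by (intro Cauchy_product_sums) (auto simp: sums_iff abs_mult summable_geometric)
  also have "(\<lambda>n. \<Sum>i\<le>n. (z ^ i * g i) * z ^ (n - i)) = (\<lambda>n. z ^ n * (\<Sum>i\<le>n. g i))"
  proof
    fix n
    have "(z ^ i * g i) * z ^ (n - i) = z ^ n * g i" if "i \<le> n" for i
    proof -
      have "z ^ n = z ^ i * z ^ (n - i)" using that by (simp flip: power_add)
      then show ?thesis by simp
    qed
    then show "(\<Sum>i\<le>n. (z ^ i * g i) * z ^ (n - i)) = z ^ n * (\<Sum>i\<le>n. g i)"
      unfolding sum_distrib_left by (intro sum.cong) auto
  qed
  also have "(\<Sum>n. z ^ n * g n) * (\<Sum>n. z ^ n) = k / (1 - z)"
    using g z suminf_geometric[of z] by (simp add: sums_iff)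
  finally show ?thesis .
qed

lemma power_series_convolution:
  fixes g r :: "nat \<Rightarrow> real"
  assumes g: "(\<lambda>n. z ^ n * g n) sums k" and r: "(\<lambda>n. z ^ n * r n) sums q"
    and pos: "\<And>n. 0 \<le> g n" "\<And>n. 0 \<le> r n" and z: "0 \<le> z"
  shows "(\<lambda>n. z ^ n * (\<Sum>i\<le>n. g i * r (n - i))) sums (k * q)"
proof -
  have "(\<lambda>n. \<Sum>i\<le>n. (z ^ i * g i) * (z ^ (n - i) * r (n - i))) sums ((\<Sum>n. z ^ n * g n) * (\<Sum>n. z ^ n * r n))"
    using g r pos z by (intro Cauchy_product_sums) (auto simp: sums_iff abs_mult)
  also have "(\<lambda>n. \<Sum>i\<le>n. (z ^ i * g i) * (z ^ (n - i) * r (n - i))) = (\<lambda>n. z ^ n * (\<Sum>i\<le>n. g i * r (n - i)))"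
  proof
    fix n
    have "(z ^ i * g i) * (z ^ (n - i) * r (n - i)) = z ^ n * (g i * r (n - i))" if "i \<le> n" for i
    proof -
      have "z ^ n = z ^ i * z ^ (n - i)" using that by (simp flip: power_add)
      then show ?thesis by simp
    qed
    then show "(\<Sum>i\<le>n. (z ^ i * g i) * (z ^ (n - i) * r (n - i))) = z ^ n * (\<Sum>i\<le>n. g i * r (n - i))"
      unfolding sum_distrib_left by (intro sum.cong) auto
  qed
  also have "(\<Sum>n. z ^ n * g n) * (\<Sum>n. z ^ n * r n) = k * q"
    using g r by (simp add: sums_iff)
  finally show ?thesis .
qed

lemma abs_ratio: "0 < F \<Longrightarrow> \<bar>G - F\<bar> / F = \<bar>G / F - 1\<bar>" for F G :: real
proof -
  assume F: "0 < F"
  then have "G / F - 1 = (G - F) / F" by (simp add: diff_divide_distrib)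
  then show ?thesis using F by (simp add: abs_divide)
qed

text \<open>Beyond some \<open>N\<close> each \<open>g n\<close> differs from \<open>f n\<close> by
  at most \<open>e / 2 * f n\<close>, and this relative error survives summation because
  \<open>f\<close> is positive.\<close>

lemma tail_sum_ratio:
  fixes f g :: "nat \<Rightarrow> real"
  assumes f: "\<And>n. 0 < f n" "summable f" and g: "summable g"
    and lim: "(\<lambda>n. g n / f n) \<longlonglongrightarrow> 1"
  shows "(\<lambda>j. (\<Sum>n. g (j + Suc n)) / (\<Sum>n. f (j + Suc n))) \<longlonglongrightarrow> 1"
proof -
  have sf: "summable (\<lambda>n. f (j + Suc n))" and sg: "summable (\<lambda>n. g (j + Suc n))" for j
    using f(2) g summable_iff_shift[of f "Suc j"] summable_iff_shift[of g "Suc j"] by (simp_all add: add_ac)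
  have F: "0 < (\<Sum>n. f (j + Suc n))" for j
    by (rule suminf_pos[OF sf f(1)])
  show ?thesis
  proof (rule LIMSEQ_I)
    fix e :: real assume e: "0 < e"
    obtain N where N: "\<And>n. n \<ge> N \<Longrightarrow> \<bar>g n / f n - 1\<bar> < e / 2"
      using LIMSEQ_D[OF lim, of "e / 2"] e by auto
    have "norm ((\<Sum>n. g (j + Suc n)) / (\<Sum>n. f (j + Suc n)) - 1) < e" if j: "j \<ge> N" for j
    proof -
      have le: "\<bar>g n - f n\<bar> \<le> e / 2 * f n" if "n \<ge> N" for n
      proof -
        have "\<bar>g n - f n\<bar> = \<bar>g n / f n - 1\<bar> * f n"
          using abs_ratio[OF f(1)[of n], of "g n"] f(1)[of n] by (simp add: divide_eq_eq)
        then show ?thesis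
          using N[OF that] f(1)[of n] by (simp add: mult_right_mono)
      qed
      have "\<bar>(\<Sum>n. g (j + Suc n)) - (\<Sum>n. f (j + Suc n))\<bar> = \<bar>\<Sum>n. g (j + Suc n) - f (j + Suc n)\<bar>"
        using suminf_diff[OF sg sf] by simp
      also have "\<dots> \<le> (\<Sum>n. e / 2 * f (j + Suc n))"
      proof -
        have le': "norm (g (j + Suc n) - f (j + Suc n)) \<le> e / 2 * f (j + Suc n)" for n
          using le[of "j + Suc n"] j by simp
        note T = summable_mult[OF sf, of "e / 2"]
        have S: "summable (\<lambda>n. norm (g (j + Suc n) - f (j + Suc n)))"
          by (rule summable_comparison_test'[OF T]) (use le' in auto)
        show ?thesis
          using order_trans[OF summable_norm[OF S] suminf_le[OF le' S T]] by simp
      qed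
      also have "\<dots> = e / 2 * (\<Sum>n. f (j + Suc n))" by (rule suminf_mult[OF sf])
      finally have "\<bar>(\<Sum>n. g (j + Suc n)) - (\<Sum>n. f (j + Suc n))\<bar> / (\<Sum>n. f (j + Suc n)) \<le> e / 2"
        using F[of j] by (simp only: pos_divide_le_eq)
      also have "\<bar>(\<Sum>n. g (j + Suc n)) - (\<Sum>n. f (j + Suc n))\<bar> / (\<Sum>n. f (j + Suc n))
          = \<bar>(\<Sum>n. g (j + Suc n)) / (\<Sum>n. f (j + Suc n)) - 1\<bar>"
        by (rule abs_ratio[OF F])
      finally show ?thesis using e by simp
    qed
    then show "\<exists>no. \<forall>n\<ge>no. norm ((\<Sum>i. g (n + Suc i)) / (\<Sum>i. f (n + Suc i)) - 1) < e" by blast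
  qed
qed

lemma exp_minus_lipschitz:
  assumes "0 \<le> (x::real)" "0 \<le> s" "s \<le> t"
  shows "exp (- s * x) - exp (- t * x) \<le> x * (t - s)"
proof -
  have "exp (- s * x) - exp (- t * x) = exp (- s * x) * (1 - exp (- ((t - s) * x)))"
    by (simp add: right_diff_distrib left_diff_distrib flip: exp_add)
  also have "\<dots> \<le> 1 * ((t - s) * x)"
  proof (intro mult_mono)
    show "1 - exp (- ((t - s) * x)) \<le> (t - s) * x"
      using exp_ge_add_one_self[of "- ((t - s) * x)"] by linarith
  qed (use assms in auto)
  finally show ?thesis by (simp add: mult.commute)
qed

section \<open>Service laws with finite mean: Laplace transform and renewal equation\<close>

locale service_law_mean = service_law +
  assumes int: "integrable S (\<lambda>x. x)"
begin

abbreviation m :: real where "m \<equiv> mean_service S"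

lemma mean_pos: "0 < m"
proof -
  have "0 \<le> m" unfolding mean_service_def
    using AE_pos by (intro integral_nonneg_AE) auto
  moreover have "m \<noteq> 0"
  proof
    assume "m = 0"
    then have "AE x in S. x = 0"
      unfolding mean_service_def using AE_pos int by (subst (asm) integral_nonneg_eq_0_iff_AE) auto
    with AE_pos have "AE x in S. False" by eventually_elim simp
    then show False by (simp add: AE_False)
  qed
  ultimately show ?thesis by simp
qed

lemma integrable_exp: "0 \<le> s \<Longrightarrow> integrable S (\<lambda>x. exp (- s * x))"
  by (rule integrable_const_bound[where B=1]) (use AE_pos in auto)

lemma LST_0: "LST S 0 = 1"
  using prob_UNIV by (simp add: LST_def)

lemma LST_antimono:
  assumes "0 \<le> s" "s \<le> t"
  shows "LST S t \<le> LST S s"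
  unfolding LST_def
proof (rule integral_mono_AE)
  show "AE x in S. exp (- t * x) \<le> exp (- s * x)"
    using AE_pos by eventually_elim (use assms in auto)
qed (use assms integrable_exp in auto)

lemma LST_lipschitz:
  assumes "0 \<le> s" "s \<le> t"
  shows "LST S s - LST S t \<le> m * (t - s)"
proof -
  have "LST S s - LST S t = (\<integral>x. exp (- s * x) - exp (- t * x) \<partial>S)"
    unfolding LST_def using assms integrable_exp[of s] integrable_exp[of t] by simp
  also have "\<dots> \<le> (\<integral>x. x * (t - s) \<partial>S)"
  proof (rule integral_mono_AE)
    show "AE x in S. exp (- s * x) - exp (- t * x) \<le> x * (t - s)"
      using AE_pos by eventually_elim (use assms exp_minus_lipschitz in auto)
    show "integrable S (\<lambda>x. exp (- s * x) - exp (- t * x))"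
      using assms integrable_exp[of s] integrable_exp[of t] by simp
  qed (use int in auto)
  also have "\<dots> = m * (t - s)" by (simp add: mean_service_def)
  finally show ?thesis .
qed

lemma LST_pos: "0 \<le> LST S s"
  unfolding LST_def by (intro integral_nonneg_AE) auto

lemma LST_le_1: "0 \<le> s \<Longrightarrow> LST S s \<le> 1"
  using LST_antimono[of 0 s] LST_0 by simp

lemma LST_ge: "0 \<le> s \<Longrightarrow> 1 - LST S s \<le> m * s"
  using LST_lipschitz[of 0 s] LST_0 by simp

text \<open>The right derivative of the transform at 0, by dominated convergence; the majorant is
  the service time itself, by \<open>exp_minus_lipschitz\<close>.\<close>

lemma LST_quotient_tendsto:
  assumes "\<And>n. 0 < s n" "s \<longlonglongrightarrow> 0"
  shows "(\<lambda>n. (1 - LST S (s n)) / s n) \<longlonglongrightarrow> m"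
proof -
  have "(\<lambda>n. \<integral>x. (1 - exp (- s n * x)) / s n \<partial>S) \<longlonglongrightarrow> (\<integral>x. x \<partial>S)"
  proof (rule integral_dominated_convergence[where w="\<lambda>x. \<bar>x\<bar>"])
    show "integrable S (\<lambda>x. \<bar>x\<bar>)" using int by simp
    have D: "((\<lambda>t. (1 - exp (- t * x)) / t) \<longlongrightarrow> x) (at_right 0)" for x :: real
    proof -
      have "((\<lambda>t. 1 - exp (- t * x)) has_real_derivative x) (at 0)"
        by (auto intro!: derivative_eq_intros)
      then have "((\<lambda>t. (1 - exp (- t * x)) / t) \<longlongrightarrow> x) (at 0)"
        by (simp add: has_field_derivative_iff)
      then show ?thesis by (rule tendsto_within_subset) simp
    qed
    have s: "filterlim s (at_right 0) sequentially"
      using assms by (intro tendsto_imp_filterlim_at_right) auto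
    show "AE x in S. (\<lambda>n. (1 - exp (- s n * x)) / s n) \<longlonglongrightarrow> x"
      by (intro AE_I2 filterlim_compose[OF D s])
    show "AE x in S. norm ((1 - exp (- s n * x)) / s n) \<le> \<bar>x\<bar>" for n
      using AE_pos
    proof eventually_elim
      case (elim x)
      have "0 \<le> 1 - exp (- s n * x)" using elim assms(1)[of n] by simp
      moreover have "1 - exp (- s n * x) \<le> x * s n"
        using exp_minus_lipschitz[of x 0 "s n"] elim assms(1)[of n] by simp
      ultimately show ?case
        using elim assms(1)[of n] by (simp add: pos_divide_le_eq)
    qed
  qed auto
  also have "(\<lambda>n. \<integral>x. (1 - exp (- s n * x)) / s n \<partial>S) = (\<lambda>n. (1 - LST S (s n)) / s n)"
  proof
    fix n
    show "(\<integral>x. (1 - exp (- s n * x)) / s n \<partial>S) = (1 - LST S (s n)) / s n"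
      using integrable_exp[of "s n"] assms(1)[of n] prob_UNIV by (simp add: LST_def)
  qed
  finally show ?thesis by (simp add: mean_service_def)
qed

text \<open>The generating function of \<open>mixed_tail S c\<close>. Divided by its limit
  \<open>c * m\<close> at 1, it generates the law of the number of arrivals during a stationary
  residual service time.\<close>

definition K :: "real \<Rightarrow> real" where
  "K z = (1 - LST S (c * (1 - z))) / (1 - z)"

lemma K_le: "z < 1 \<Longrightarrow> K z \<le> c * m"
  using LST_ge[of "c * (1 - z)"] c_pos by (simp add: K_def pos_divide_le_eq mult_ac)

lemma K_tendsto:
  assumes "\<And>n. z n < 1" "z \<longlonglongrightarrow> 1"
  shows "(\<lambda>n. K (z n)) \<longlonglongrightarrow> c * m"
proof -
  have "(\<lambda>n. c * (1 - z n)) \<longlonglongrightarrow> c * (1 - 1)" by (intro tendsto_intros assms)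
  then have "(\<lambda>n. (1 - LST S (c * (1 - z n))) / (c * (1 - z n))) \<longlonglongrightarrow> m"
    using assms c_pos by (intro LST_quotient_tendsto) auto
  then have "(\<lambda>n. c * ((1 - LST S (c * (1 - z n))) / (c * (1 - z n)))) \<longlonglongrightarrow> c * m"
    by (intro tendsto_intros)
  then show ?thesis using c_pos by (simp add: K_def)
qed

text \<open>The sum is the expected number of arrivals during one service. It is obtained from
  \<open>K\<close> by letting \<open>z\<close> increase to 1; since the coefficients are
  nonnegative, finite sums are bounded by \<open>c * m\<close> and the full sum bounds every
  \<open>K (z n)\<close>.\<close>

lemma mixed_tail_sums: "mixed_tail S c sums (c * m)"
proof -
  define z where "z n = 1 - 1 / real (Suc n)" for n
  have z: "0 \<le> z n" "z n < 1" for n by (auto simp: z_def)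
  have z1: "z \<longlonglongrightarrow> 1" unfolding z_def by real_asymp
  have gf: "(\<lambda>i. z n ^ i * mixed_tail S c i) sums K (z n)" for n
    unfolding K_def by (rule mixed_tail_generating_function[OF z])
  have part: "(\<Sum>i\<in>A. mixed_tail S c i) \<le> c * m" if A: "finite A" for A
  proof (rule LIMSEQ_le_const2)
    show "(\<lambda>n. \<Sum>i\<in>A. z n ^ i * mixed_tail S c i) \<longlonglongrightarrow> (\<Sum>i\<in>A. mixed_tail S c i)"
    proof -
      have "(\<lambda>n. \<Sum>i\<in>A. z n ^ i * mixed_tail S c i) \<longlonglongrightarrow> (\<Sum>i\<in>A. 1 ^ i * mixed_tail S c i)"
        by (intro tendsto_intros z1)
      then show ?thesis by simp
    qed
    have "(\<Sum>i\<in>A. z n ^ i * mixed_tail S c i) \<le> c * m" for n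
    proof -
      have "(\<Sum>i\<in>A. z n ^ i * mixed_tail S c i) \<le> K (z n)"
        using sum_le_suminf[OF sums_summable[OF gf] A, of n] z[of n] mixed_tail_nonneg sums_unique[OF gf[of n]]
        by simp
      then show ?thesis using K_le[OF z(2)] order_trans by blast
    qed
    then show "\<exists>N. \<forall>n\<ge>N. (\<Sum>i\<in>A. z n ^ i * mixed_tail S c i) \<le> c * m" by blast
  qed
  have S: "summable (mixed_tail S c)"
    by (rule bounded_imp_summable[of _ "c * m"]) (use mixed_tail_nonneg part in auto)
  moreover have "(\<Sum>i. mixed_tail S c i) \<le> c * m"
    by (rule suminf_le_const[OF S]) (use part in auto)
  moreover have "c * m \<le> (\<Sum>i. mixed_tail S c i)"
  proof (rule LIMSEQ_le_const2[OF K_tendsto[OF z(2) z1]])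
    have "K (z n) \<le> (\<Sum>i. mixed_tail S c i)" for n
    proof -
      have "z n ^ i * mixed_tail S c i \<le> mixed_tail S c i" for i
        using z[of n] mixed_tail_nonneg[of i] by (simp add: mult_left_le_one_le power_le_one)
      then show ?thesis
        using suminf_le[OF _ sums_summable[OF gf] S] sums_unique[OF gf[of n]] by simp
    qed
    then show "\<exists>N. \<forall>n\<ge>N. K (z n) \<le> (\<Sum>i. mixed_tail S c i)" by blast
  qed
  ultimately show ?thesis by (simp add: sums_iff)
qed

definition W :: "nat \<Rightarrow> real" where
  "W j = (\<Sum>n. mixed_tail S c (j + Suc n))"

lemma W_eq: "W j = c * m - (\<Sum>i\<le>j. mixed_tail S c i)"
  using sums_split_initial_segment[OF mixed_tail_sums, of "Suc j"]
  by (simp add: W_def sums_iff lessThan_Suc_atMost add_ac)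

lemma W_generating_function:
  assumes "0 \<le> z" "z < 1"
  shows "(\<lambda>j. z ^ j * W j) sums ((c * m - K z) / (1 - z))"
proof -
  have "(\<lambda>j. c * m * z ^ j) sums (c * m * (1 / (1 - z)))"
    using assms by (intro sums_mult geometric_sums) auto
  moreover have "(\<lambda>j. z ^ j * (\<Sum>i\<le>j. mixed_tail S c i)) sums (K z / (1 - z))"
    using assms mixed_tail_nonneg mixed_tail_generating_function[OF assms]
    unfolding K_def by (intro power_series_partial_sums) auto
  ultimately have "(\<lambda>j. c * m * z ^ j - z ^ j * (\<Sum>i\<le>j. mixed_tail S c i)) sums (c * m * (1 / (1 - z)) - K z / (1 - z))"
    by (rule sums_diff)
  then show ?thesis
    by (simp add: W_eq right_diff_distrib diff_divide_distrib mult.commute)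
qed

text \<open>Multiplying the generating function of \<open>Q\<close> by \<open>1 - K z\<close> leaves
  that of \<open>W j / (c * m)\<close>, and the product with \<open>K z\<close> is a convolution.
  The condition \<open>stable\<close> keeps \<open>1 - K z\<close> positive, so the denominator may
  be cleared.\<close>

lemma renewal_equation:
  assumes Q: "\<And>j. 0 \<le> Q j"
    and gf: "\<And>z. 0 < z \<Longrightarrow> z < 1 \<Longrightarrow> (\<lambda>j. z ^ j * Q j) sums ((c * m - K z) / (c * m * (1 - K z) * (1 - z)))"
    and stable: "c * m < 1"
  shows "Q j = W j / (c * m) + (\<Sum>i\<le>j. mixed_tail S c i * Q (j - i))"
proof -
  define A where "A j = Q j - W j / (c * m) - (\<Sum>i\<le>j. mixed_tail S c i * Q (j - i))" for j
  have "A j = 0"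
  proof (rule power_series_eq_0)
    fix z :: real assume z: "0 < z" "z < 1"
    let ?q = "(c * m - K z) / (c * m * (1 - K z) * (1 - z))"
    have K1: "K z < 1" using K_le[OF z(2)] stable by simp
    have "(\<lambda>n. z ^ n * (\<Sum>i\<le>n. mixed_tail S c i * Q (n - i))) sums (K z * ?q)"
      using z Q mixed_tail_nonneg mixed_tail_generating_function[of z]
      by (intro power_series_convolution gf) (auto simp: K_def)
    moreover have "(\<lambda>n. z ^ n * W n / (c * m)) sums ((c * m - K z) / (1 - z) / (c * m))"
      using z by (intro sums_divide W_generating_function) auto
    ultimately have "(\<lambda>n. z ^ n * Q n - z ^ n * W n / (c * m) - z ^ n * (\<Sum>i\<le>n. mixed_tail S c i * Q (n - i)))
        sums (?q - (c * m - K z) / (1 - z) / (c * m) - K z * ?q)"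
      by (intro sums_diff gf z)
    also have "?q - (c * m - K z) / (1 - z) / (c * m) - K z * ?q = 0"
    proof -
      have "x / (y * k * w) - x / w / y - (1 - k) * (x / (y * k * w)) = 0" if "k \<noteq> 0" for x y k w :: real
      proof -
        have "k * (x / (y * k * w)) = x / w / y" using that by simp
        then show ?thesis unfolding left_diff_distrib by linarith
      qed
      from this[of "1 - K z"] K1 show ?thesis by simp
    qed
    also have "(\<lambda>n. z ^ n * Q n - z ^ n * W n / (c * m) - z ^ n * (\<Sum>i\<le>n. mixed_tail S c i * Q (n - i)))
        = (\<lambda>n. z ^ n * A n)"
      by (simp only: A_def right_diff_distrib times_divide_eq_right)
    finally show "(\<lambda>n. z ^ n * A n) sums 0" .
  qed
  then show ?thesis by (simp add: A_def)
qed

end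

section \<open>Regular variation of the forcing term\<close>

locale regvar_service_mean = regvar_service + service_law_mean +
  assumes stable: "c * m < 1"
begin

lemma mixed_tail_pos: "0 < mixed_tail S c n"
proof -
  have "exp (- 1) * (\<Sum>k\<le>n. 1 ^ k / fact k) < exp (- 1) * exp (1::real)"
  proof (intro mult_strict_left_mono)
    have "(\<Sum>k\<le>n. 1 ^ k / fact k) < (\<Sum>k\<le>Suc n. 1 ^ k / (fact k :: real))" by simp
    also have "\<dots> \<le> exp 1" by (intro exp_partial_sum_le) auto
    finally show "(\<Sum>k\<le>n. 1 ^ k / fact k) < exp (1::real)" .
  qed auto
  then have "0 < poisson_tail n 1"
    by (simp add: poisson_tail_def flip: exp_add)
  then have "0 < f 1 * poisson_tail n 1" using pos[of 1] by simp
  also have "\<dots> \<le> mixed_tail S c n" by (intro mixed_tail_ge) auto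
  finally show ?thesis .
qed

lemma W_pos: "0 < W j"
proof -
  have "summable (\<lambda>n. mixed_tail S c (j + Suc n))"
    using sums_summable[OF mixed_tail_sums] summable_iff_shift[of "mixed_tail S c" "Suc j"] by (simp add: add_ac)
  then show ?thesis unfolding W_def using mixed_tail_pos by (intro suminf_pos)
qed

lemma W_asymp: "(\<lambda>j. W j / (real j * f (real j))) \<longlonglongrightarrow> 1 / (a - 1)"
proof -
  have "(\<lambda>j. W j / (\<Sum>n. f (real (j + Suc n))) * ((\<Sum>n. f (real (j + Suc n))) / (real j * f (real j))))
      \<longlonglongrightarrow> 1 * (1 / (a - 1))"
    unfolding W_def
    by (intro tendsto_mult karamata_tail_sum a_gt_1 tail_sum_ratio pos summable_values mixed_tail_equiv
        sums_summable[OF mixed_tail_sums])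
  moreover have "(\<Sum>n. f (real (j + Suc n))) \<noteq> 0" for j
  proof -
    have "summable (\<lambda>n. f (real (j + Suc n)))"
      using summable_values[OF a_gt_1] summable_iff_shift[of "\<lambda>n. f (real n)" "Suc j"] by (simp add: add_ac)
    then have "0 < (\<Sum>n. f (real (j + Suc n)))" by (intro suminf_pos pos)
    then show ?thesis by simp
  qed
  ultimately show ?thesis by simp
qed

lemma W_regular:
  assumes "1 < b"
  shows "\<exists>\<epsilon>>0. \<epsilon> < 1 \<and> (\<forall>\<^sub>F j in sequentially. \<forall>i. real i \<le> \<epsilon> * real j \<longrightarrow> W (j - i) \<le> b * W j)"
proof -
  \<comment> \<open>Three estimates each lose a factor \<open>d\<close>: \<open>W\<close> from above
    at \<open>j - i\<close>, the shift of the argument of \<open>f\<close>, and \<open>W\<close>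
    from below at \<open>j\<close>. The fourth factor is spare.\<close>
  define d where "d = b powr (1 / 4)"
  have d: "1 < d" "d * d * (d * d) = b"
    using assms by (auto simp: d_def simp flip: powr_add)
  have "((\<lambda>e. (1 - e) powr - a) \<longlongrightarrow> (1 - 0) powr - a) (at_right 0)"
    by (intro tendsto_intros) auto
  then have "\<forall>\<^sub>F e in at_right 0. (1 - e) powr - a < d"
    using d by (intro order_tendstoD) auto
  moreover have "\<forall>\<^sub>F e in at_right (0::real). e \<in> {0<..<1}"
    by (rule eventually_at_right_real) simp
  ultimately have "\<exists>e. (1 - e) powr - a < d \<and> e \<in> {0<..<1}"
    by (intro eventually_happens'[OF trivial_limit_at_right_real] eventually_conj)
  then obtain e where e: "(1 - e) powr - a < d" "0 < e" "e < 1" by auto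
  define C where "C = 1 / (a - 1)"
  have C: "0 < C" using a_gt_1 by (simp add: C_def)
  have "\<forall>\<^sub>F j in sequentially. W j / (real j * f (real j)) < C * d"
    using d C by (intro order_tendstoD[OF W_asymp]) (auto simp: C_def[symmetric])
  then obtain N where N: "\<And>j. j \<ge> N \<Longrightarrow> W j / (real j * f (real j)) < C * d"
    unfolding eventually_sequentially by blast
  have "\<forall>\<^sub>F j in sequentially. C / d < W j / (real j * f (real j))"
    using d C by (intro order_tendstoD[OF W_asymp]) (auto simp: C_def[symmetric] field_simps)
  moreover have "\<forall>\<^sub>F j in sequentially. f ((1 - e) * real j) / f (real j) < d"
    using e by (intro order_tendstoD[OF filterlim_compose[OF ratio filterlim_real_sequentially]]) auto
  moreover have "\<forall>\<^sub>F j in sequentially. real (N + 1) < (1 - e) * real j"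
    using e by real_asymp
  ultimately have "\<forall>\<^sub>F j in sequentially. \<forall>i. real i \<le> e * real j \<longrightarrow> W (j - i) \<le> b * W j"
  proof eventually_elim
    case (elim j)
    show ?case
    proof (intro allI impI)
      fix i assume i: "real i \<le> e * real j"
      have j: "0 < real j" using elim(3) e by (cases "j = 0") auto
      have "e * real j \<le> 1 * real j" using e by (intro mult_right_mono) auto
      then have "i \<le> j" using i by simp
      then have ji: "(1 - e) * real j \<le> real (j - i)" using i by (simp add: algebra_simps of_nat_diff)
      then have big: "N \<le> j - i" "0 < real (j - i)" using elim(3) by linarith+
      have "W (j - i) \<le> C * d * (real (j - i) * f (real (j - i)))"
        using N[OF big(1)] big(2) pos by (simp add: pos_divide_less_eq less_imp_le)
      also have "\<dots> \<le> C * d * (real j * f ((1 - e) * real j))"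
        using C d ji by (intro mult_left_mono mult_mono anti) auto
      also have "\<dots> \<le> C * d * (real j * (d * f (real j)))"
        using C d elim(2) pos[of "real j"] by (intro mult_left_mono) (auto simp: pos_divide_less_eq)
      also have "\<dots> = d * d * (C * (real j * f (real j)))" by simp
      also have "\<dots> \<le> d * d * (d * W j)"
        using elim(1) j pos[of "real j"] d by (intro mult_left_mono) (auto simp: field_simps)
      also have "\<dots> \<le> d * d * (d * (d * W j))"
        using d W_pos[of j] by (intro mult_left_mono) auto
      also have "\<dots> = b * W j" by (simp flip: d(2))
      finally show "W (j - i) \<le> b * W j" .
    qed
  qed
  then show ?thesis using e by blast
qed

text \<open>For \<open>i\<close> above \<open>\<epsilon> * real j\<close> the equivalence with
  \<open>f\<close> and monotonicity bound \<open>mixed_tail S c i\<close> by a multiple of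
  \<open>f (real j)\<close>, while \<open>W j\<close> is of the larger order
  \<open>real j * f (real j)\<close>.\<close>

lemma mixed_tail_small:
  assumes "0 < \<epsilon>"
  shows "\<exists>C. \<forall>\<^sub>F j in sequentially. \<forall>i\<le>j. \<epsilon> * real j < real i \<longrightarrow> real j * mixed_tail S c i \<le> C * W j"
proof -
  have "\<forall>\<^sub>F n in sequentially. mixed_tail S c n / f (real n) < 2"
    by (rule order_tendstoD[OF mixed_tail_equiv]) simp
  then obtain N where N: "\<And>n. n \<ge> N \<Longrightarrow> mixed_tail S c n / f (real n) < 2"
    unfolding eventually_sequentially by blast
  define E where "E = \<epsilon> powr - a + 1"
  have E: "0 < E" by (simp add: E_def add_nonneg_pos)
  \<comment> \<open>Half the limit in \<open>W_asymp\<close>, hence an eventual lower bound.\<close>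
  define C where "C = 1 / (2 * (a - 1))"
  have C: "0 < C" "C < 1 / (a - 1)" using a_gt_1 by (auto simp: C_def field_simps)
  have "\<forall>\<^sub>F j in sequentially. f (\<epsilon> * real j) / f (real j) < E"
    using assms by (intro order_tendstoD[OF filterlim_compose[OF ratio filterlim_real_sequentially]]) (auto simp: E_def)
  moreover have "\<forall>\<^sub>F j in sequentially. C < W j / (real j * f (real j))"
    by (intro order_tendstoD[OF W_asymp] C)
  moreover have "\<forall>\<^sub>F j in sequentially. real N < \<epsilon> * real j"
    using assms by real_asymp
  ultimately have "\<forall>\<^sub>F j in sequentially. \<forall>i\<le>j. \<epsilon> * real j < real i \<longrightarrow> real j * mixed_tail S c i \<le> 2 * E / C * W j"
  proof eventually_elim
    case (elim j)
    show ?case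
    proof (intro allI impI)
      fix i assume i: "i \<le> j" "\<epsilon> * real j < real i"
      have j: "0 < real j" using elim(3) assms by (cases "j = 0") auto
      have "N \<le> i" using elim(3) i by linarith
      then have "mixed_tail S c i \<le> 2 * f (real i)"
        using N[of i] pos[of "real i"] by (simp add: pos_divide_less_eq)
      also have "\<dots> \<le> 2 * f (\<epsilon> * real j)" using i by (intro mult_left_mono anti) auto
      also have "\<dots> \<le> 2 * (E * f (real j))"
        using elim(1) pos[of "real j"] by (simp add: pos_divide_less_eq)
      finally have "real j * mixed_tail S c i \<le> 2 * E * (real j * f (real j))"
        using j by (simp add: mult_ac)
      also have "\<dots> \<le> 2 * E * (W j / C)"
        using elim(2) j pos[of "real j"] C E by (intro mult_left_mono) (auto simp: field_simps)
      finally show "real j * mixed_tail S c i \<le> 2 * E / C * W j" by simp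
    qed
  qed
  then show ?thesis by blast
qed

text \<open>The limit is a product of \<open>1 / (1 - c * m)\<close> from the renewal equation,
  \<open>1 / (c * m)\<close> from the normalisation of the forcing term, and
  \<open>1 / (a - 1)\<close> from Karamata's theorem.\<close>

lemma geometric_compound_tail:
  assumes Q: "\<And>j. 0 \<le> Q j" "Q \<longlonglongrightarrow> 0"
    and gf: "\<And>z. 0 < z \<Longrightarrow> z < 1 \<Longrightarrow> (\<lambda>j. z ^ j * Q j) sums ((c * m - K z) / (c * m * (1 - K z) * (1 - z)))"
  shows "(\<lambda>j. Q j / (real j * f (real j))) \<longlonglongrightarrow> 1 / (c * m * (1 - c * m) * (a - 1))"
proof -
  have cm: "0 < c * m" using c_pos mean_pos by simp
  interpret defective_renewal "mixed_tail S c" "\<lambda>j. W j / (c * m)" Q "c * m"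
  proof
    show "W j / (c * m) \<le> W i / (c * m)" if "i \<le> j" for i j
    proof -
      have "(\<Sum>k\<le>i. mixed_tail S c k) \<le> (\<Sum>k\<le>j. mixed_tail S c k)"
        using that mixed_tail_nonneg by (intro sum_mono2) auto
      then show ?thesis using cm by (intro divide_right_mono) (auto simp: W_eq)
    qed
    show "Q j = W j / (c * m) + (\<Sum>i\<le>j. mixed_tail S c i * Q (j - i))" for j
      by (rule renewal_equation[OF Q(1) gf stable])
    show "\<exists>\<epsilon>>0. \<epsilon> < 1 \<and> (\<forall>\<^sub>F j in sequentially. \<forall>i. real i \<le> \<epsilon> * real j \<longrightarrow>
        W (j - i) / (c * m) \<le> b * (W j / (c * m)))" if "1 < b" for b
      using W_regular[OF that] cm by (simp add: divide_le_cancel)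
    show "\<exists>C. \<forall>\<^sub>F j in sequentially. \<forall>i\<le>j. \<epsilon> * real j < real i \<longrightarrow>
        real j * mixed_tail S c i \<le> C * (W j / (c * m))" if eps: "0 < \<epsilon>" for \<epsilon>
    proof -
      obtain C where C: "\<forall>\<^sub>F j in sequentially. \<forall>i\<le>j. \<epsilon> * real j < real i \<longrightarrow> real j * mixed_tail S c i \<le> C * W j"
        using mixed_tail_small[OF eps] by blast
      have eq: "C * (c * m) * (W j / (c * m)) = C * W j" for j
        using c_pos mean_pos by simp
      show ?thesis
        by (rule exI[of _ "C * (c * m)"]) (simp only: eq C)
    qed
  qed (use mixed_tail_nonneg mixed_tail_sums stable W_pos cm Q in auto)
  have "(\<lambda>j. D j * (W j / (real j * f (real j))) / (c * m)) \<longlonglongrightarrow> 1 / (1 - c * m) * (1 / (a - 1)) / (c * m)"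
    using cm by (intro tendsto_intros D_tendsto W_asymp) auto
  moreover have "D j * (W j / (real j * f (real j))) / (c * m) = Q j / (real j * f (real j))" for j
    using W_pos[of j] c_pos mean_pos by simp
  ultimately show ?thesis by (simp add: mult_ac)
qed

end

section \<open>The retrial queue\<close>

locale retrial_queue = service_law_mean S "lam * q" for S and lam q :: real +
  assumes lam_pos: "0 < lam" and q: "0 < q" "q < 1" and stable: "lam * mean_service S < 1"
begin

text \<open>The slope of \<open>h\<close> at 1, found by differentiating its fixed point equation:
  the mean number of customers sent to the orbit during a busy period of the queue.\<close>

definition \<kappa> :: real where
  "\<kappa> = lam * (1 - q) * m / (1 - lam * q * m)"

lemma queue_stable: "lam * q * m < 1"
proof -
  have "lam * q * m \<le> lam * 1 * m"
    using lam_pos q mean_pos by (intro mult_right_mono mult_left_mono) auto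
  then show ?thesis using stable by simp
qed

lemma kappa: "0 < \<kappa>" "\<kappa> < 1" "1 - \<kappa> = (1 - lam * m) / (1 - lam * q * m)"
proof -
  show eq: "1 - \<kappa> = (1 - lam * m) / (1 - lam * q * m)"
    using queue_stable by (simp add: \<kappa>_def diff_divide_eq_iff field_simps)
  then have "0 < 1 - \<kappa>" using stable queue_stable by simp
  then show "\<kappa> < 1" by simp
  show "0 < \<kappa>" using lam_pos q mean_pos queue_stable by (simp add: \<kappa>_def)
qed

lemma LST_dist:
  assumes "0 \<le> s" "0 \<le> t"
  shows "\<bar>LST S s - LST S t\<bar> \<le> m * \<bar>s - t\<bar>"
proof (cases "s \<le> t")
  case True
  then show ?thesis
    using LST_lipschitz[OF assms(1) True] LST_antimono[OF assms(1) True] by simp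
next
  case False
  then have "t \<le> s" by simp
  from LST_lipschitz[OF assms(2) this] LST_antimono[OF assms(2) this] this show ?thesis by simp
qed

abbreviation arg :: "real \<Rightarrow> real \<Rightarrow> real" where
  "arg z1 z2 \<equiv> lam - lam * q * z1 - lam * (1 - q) * z2"

lemma arg_eq: "arg z1 z2 = lam * q * (1 - z1) + lam * (1 - q) * (1 - z2)"
  by (simp add: algebra_simps)

lemma arg_nonneg: "z1 \<le> 1 \<Longrightarrow> z2 \<le> 1 \<Longrightarrow> 0 \<le> arg z1 z2"
  unfolding arg_eq using lam_pos q by simp

abbreviation h :: "real \<Rightarrow> real" where "h \<equiv> rq_h lam q S"

text \<open>Banach's theorem on the unit interval: the transform has Lipschitz constant
  \<open>m\<close>, so the map contracts by \<open>lam * q * m < 1\<close>. Uniqueness is what makes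
  the description in \<open>rq_h_def\<close> meaningful.\<close>

lemma h_fixpoint:
  assumes z: "z \<le> 1"
  shows "0 \<le> h z" "h z \<le> 1" "h z = LST S (arg (h z) z)"
proof -
  have "\<exists>!x\<in>{0..1}. LST S (arg x z) = x"
  proof (rule Banach_fix)
    show "0 \<le> lam * q * m" "lam * q * m < 1"
      using lam_pos q mean_pos queue_stable by auto
    show "(\<lambda>x. LST S (arg x z)) ` {0..1} \<subseteq> {0..1}"
      using LST_pos LST_le_1 arg_nonneg[OF _ z] by auto
    show "dist (LST S (arg x z)) (LST S (arg y z)) \<le> lam * q * m * dist x y"
      if "x \<in> {0..1}" "y \<in> {0..1}" for x y
    proof -
      have "\<bar>LST S (arg x z) - LST S (arg y z)\<bar> \<le> m * \<bar>arg x z - arg y z\<bar>"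
        using that z by (intro LST_dist arg_nonneg) auto
      also have "arg x z - arg y z = lam * q * (y - x)" by (simp add: algebra_simps)
      also have "m * \<bar>lam * q * (y - x)\<bar> = lam * q * m * \<bar>x - y\<bar>"
        using lam_pos q by (simp add: abs_mult abs_minus_commute)
      finally show ?thesis by (simp add: dist_real_def)
    qed
  qed (auto intro: compact_imp_complete)
  then have "\<exists>!x. 0 \<le> x \<and> x \<le> 1 \<and> x = LST S (arg x z)"
    by (simp add: conj_assoc eq_commute)
  from theI'[OF this] show "0 \<le> h z" "h z \<le> 1" "h z = LST S (arg (h z) z)"
    unfolding rq_h_def by blast+
qed

text \<open>The bound \<open>1 - LST S s \<le> m * s\<close>, put into the fixed point equation, is
  linear in \<open>1 - h z\<close> and can be solved for it. It yields continuity of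
  \<open>h\<close> at 1 and the gap \<open>(1 - \<kappa>) * (1 - z) \<le> h z - z\<close>.\<close>

lemma one_minus_h_le:
  assumes z: "z \<le> 1"
  shows "1 - h z \<le> \<kappa> * (1 - z)"
proof -
  have "1 - h z \<le> m * arg (h z) z"
    using h_fixpoint[OF z] LST_ge[OF arg_nonneg[OF h_fixpoint(2)[OF z] z]] by simp
  then have "(1 - h z) * (1 - lam * q * m) \<le> lam * (1 - q) * m * (1 - z)"
    unfolding arg_eq by (simp add: algebra_simps)
  then have "1 - h z \<le> lam * (1 - q) * m * (1 - z) / (1 - lam * q * m)"
    using queue_stable by (simp only: pos_le_divide_eq)
  then show ?thesis by (simp add: \<kappa>_def)
qed

lemma h_tendsto:
  assumes "\<And>n. z n < 1" "z \<longlonglongrightarrow> 1"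
  shows "(\<lambda>n. h (z n)) \<longlonglongrightarrow> 1"
proof (rule tendsto_sandwich)
  show "\<forall>\<^sub>F n in sequentially. 1 - \<kappa> * (1 - z n) \<le> h (z n)"
    using one_minus_h_le assms(1) by (intro always_eventually allI) (smt (verit))
  show "\<forall>\<^sub>F n in sequentially. h (z n) \<le> 1"
    using h_fixpoint(2) assms(1) by (intro always_eventually allI) (simp add: less_imp_le)
  have "(\<lambda>n. 1 - \<kappa> * (1 - z n)) \<longlonglongrightarrow> 1 - \<kappa> * (1 - 1)" by (intro tendsto_intros assms)
  then show "(\<lambda>n. 1 - \<kappa> * (1 - z n)) \<longlonglongrightarrow> 1" by simp
qed auto

text \<open>With \<open>e n\<close> the difference quotient of the transform at \<open>s n\<close>,
  the fixed point equation is linear in \<open>1 - h (z n)\<close> and expresses the slope exactly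
  through \<open>e n\<close>. Thus differentiability of the transform at 0 is enough.\<close>

lemma h_slope_tendsto:
  assumes z: "\<And>n. z n < 1" "z \<longlonglongrightarrow> 1"
  shows "(\<lambda>n. (1 - h (z n)) / (1 - z n)) \<longlonglongrightarrow> \<kappa>"
proof -
  define s where "s n = arg (h (z n)) (z n)" for n
  define e where "e n = (1 - LST S (s n)) / s n" for n
  have hz: "h (z n) \<le> 1" "h (z n) = LST S (s n)" for n
    using h_fixpoint[of "z n"] z(1)[of n] by (auto simp: s_def)
  have s_eq: "s n = lam * q * (1 - h (z n)) + lam * (1 - q) * (1 - z n)" for n
    by (simp only: s_def arg_eq)
  have s_pos: "0 < s n" for n
    unfolding s_eq using hz(1)[of n] z(1)[of n] lam_pos q by (intro add_nonneg_pos) auto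
  have "s \<longlonglongrightarrow> lam - lam * q * 1 - lam * (1 - q) * 1"
    unfolding s_def by (intro tendsto_intros h_tendsto z)
  then have "s \<longlonglongrightarrow> 0" by (simp add: algebra_simps)
  then have e: "e \<longlonglongrightarrow> m"
    unfolding e_def by (intro LST_quotient_tendsto s_pos)
  have "(\<lambda>n. lam * (1 - q) * e n / (1 - lam * q * e n)) \<longlonglongrightarrow> lam * (1 - q) * m / (1 - lam * q * m)"
    using queue_stable by (intro tendsto_intros e) auto
  moreover have "lam * (1 - q) * e n / (1 - lam * q * e n) = (1 - h (z n)) / (1 - z n)" for n
  proof -
    have "1 - h (z n) = e n * s n" using s_pos[of n] hz(2)[of n] by (simp add: e_def)
    then have eq: "(1 - h (z n)) * (1 - lam * q * e n) = lam * (1 - q) * e n * (1 - z n)"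
      unfolding s_eq by (simp add: algebra_simps)
    have "e n \<le> m"
      using LST_ge[of "s n"] s_pos[of n] by (simp add: e_def pos_divide_le_eq)
    then have "lam * q * e n \<le> lam * q * m"
      using lam_pos q by (intro mult_left_mono) auto
    then have "0 < 1 - lam * q * e n" using queue_stable by simp
    then show ?thesis using eq z(1)[of n] by (subst frac_eq_eq) auto
  qed
  ultimately show ?thesis by (simp add: \<kappa>_def)
qed

section \<open>Limits of the factors of the Choi-Park formula\<close>

lemma M_c_tendsto:
  assumes z: "\<And>n. z n < 1" "z \<longlonglongrightarrow> 1"
  shows "(\<lambda>n. M_c lam q S (z n)) \<longlonglongrightarrow> 1"
proof -
  have "(\<lambda>n. (1 - \<kappa>) * (1 / (1 - (1 - h (z n)) / (1 - z n)))) \<longlonglongrightarrow> (1 - \<kappa>) * (1 / (1 - \<kappa>))"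
    using kappa(1,2) by (intro tendsto_intros h_slope_tendsto z) auto
  moreover have "1 / (1 - (1 - h (z n)) / (1 - z n)) = (1 - z n) / (h (z n) - z n)" for n
  proof -
    have "1 - (1 - h (z n)) / (1 - z n) = (h (z n) - z n) / (1 - z n)"
      using z(1)[of n] by (simp add: field_simps)
    then show ?thesis by simp
  qed
  moreover have "(1 - \<kappa>) * (1 / (1 - \<kappa>)) = 1" using kappa(1,2) by simp
  \<comment> \<open>By \<open>kappa(3)\<close> the constant in front of \<open>M_c\<close> is
    exactly \<open>1 - \<kappa>\<close>, so it cancels the limit of the quotient.\<close>
  ultimately show ?thesis
    unfolding M_c_def kappa(3)[symmetric] by (simp only:)
qed

text \<open>The integrand is bounded by \<open>\<kappa> / (1 - \<kappa>)\<close>, because numerator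
  and denominator both compare with \<open>1 - u\<close>; the integral is therefore of order
  \<open>1 - z n\<close>.\<close>

lemma R_0_tendsto:
  assumes z: "\<And>n. 0 \<le> z n" "\<And>n. z n < 1" "z \<longlonglongrightarrow> 1"
  shows "(\<lambda>n. R_0 lam q \<mu> S (z n)) \<longlonglongrightarrow> 1"
proof -
  let ?i = "\<lambda>u. (1 - h u) / (h u - u)"
  have bound: "\<bar>?i u\<bar> \<le> \<kappa> / (1 - \<kappa>)" if "u \<le> 1" for u
  proof (cases "u = 1")
    case True
    \<comment> \<open>At the endpoint the quotient is \<open>0 / 0\<close>, which has the value
      0.\<close>
    then have "h u = 1" using one_minus_h_le[of 1] h_fixpoint(2)[of 1] by simp
    then show ?thesis using True kappa(1,2) by simp
  next
    case False
    then have u: "u < 1" using that by simp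
    have le: "1 - h u \<le> \<kappa> * (1 - u)" by (rule one_minus_h_le[OF that])
    then have d: "(1 - \<kappa>) * (1 - u) \<le> h u - u" by (simp add: algebra_simps)
    have d0: "0 < (1 - \<kappa>) * (1 - u)" using kappa(1,2) u by simp
    have "0 \<le> ?i u" using h_fixpoint(2)[OF that] d d0 by (intro divide_nonneg_nonneg) linarith+
    moreover have "?i u \<le> (\<kappa> * (1 - u)) / ((1 - \<kappa>) * (1 - u))"
      using kappa(1,2) u by (intro frac_le le d d0) simp
    moreover have "(\<kappa> * (1 - u)) / ((1 - \<kappa>) * (1 - u)) = \<kappa> / (1 - \<kappa>)" using u by simp
    ultimately show ?thesis by (simp only: abs_of_nonneg)
  qed
  have int_bound: "\<bar>LBINT u:{z n..1}. ?i u\<bar> \<le> \<kappa> / (1 - \<kappa>) * (1 - z n)" for n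
  proof -
    let ?C = "\<kappa> / (1 - \<kappa>)"
    have C: "0 \<le> ?C" using kappa(1,2) by simp
    have fin: "integrable lborel (\<lambda>u. indicator {z n..1} u *\<^sub>R ?C)"
      using z(2)[of n] by (intro integrable_scaleR_left integrable_real_indicator) auto
    have "\<bar>LBINT u:{z n..1}. ?i u\<bar> \<le> (\<integral>u. norm (indicator {z n..1} u *\<^sub>R ?i u) \<partial>lborel)"
      unfolding set_lebesgue_integral_def real_norm_def[symmetric] by (rule integral_norm_bound)
    also have "\<dots> \<le> (\<integral>u. indicator {z n..1} u *\<^sub>R ?C \<partial>lborel)"
    proof (rule integral_mono'[OF fin])
      show "norm (indicator {z n..1} u *\<^sub>R ?i u) \<le> indicator {z n..1} u *\<^sub>R ?C" for u
      proof (cases "u \<in> {z n..1}")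
        case True
        then show ?thesis using bound[of u] by simp
      qed simp
      show "0 \<le> indicator {z n..1} u *\<^sub>R ?C" for u :: real
        by (rule scaleR_nonneg_nonneg[OF indicator_pos_le C])
    qed
    also have "\<dots> = ?C * (1 - z n)" using z(2)[of n] by simp
    finally show ?thesis .
  qed
  have "(\<lambda>n. LBINT u:{z n..1}. ?i u) \<longlonglongrightarrow> 0"
  proof (rule Lim_null_comparison)
    show "\<forall>\<^sub>F n in sequentially. norm (LBINT u:{z n..1}. ?i u) \<le> \<kappa> / (1 - \<kappa>) * (1 - z n)"
      unfolding real_norm_def by (intro always_eventually allI int_bound)
    show "(\<lambda>n. \<kappa> / (1 - \<kappa>) * (1 - z n)) \<longlonglongrightarrow> 0"
      using tendsto_mult_left[OF tendsto_diff[OF tendsto_const z(3), of 1], of "\<kappa> / (1 - \<kappa>)"] by simp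
  qed
  from tendsto_exp[OF tendsto_mult_left[OF this, of "- (lam / \<mu>)"]] show ?thesis
    by (simp add: R_0_def)
qed

text \<open>At \<open>z2 = 1\<close> the denominators become \<open>q * (1 - w)\<close> and
  \<open>(1 - w) * (1 - K w)\<close>. The factors \<open>1 - w\<close> cancel, leaving
  \<open>K w / (lam * q * m)\<close> and \<open>(1 - lam * q * m) / (1 - K w)\<close>.\<close>

lemma M_a_M_b_tendsto:
  assumes z: "\<And>n. 0 \<le> z n" "\<And>n. z n < 1" "z \<longlonglongrightarrow> 1" and w: "0 \<le> w" "w < 1"
  shows "(\<lambda>n. M_a lam q S w (z n) * M_b lam q S w (z n))
    \<longlonglongrightarrow> (1 - lam * q * m) * K w / (lam * q * m * (1 - K w))"
proof -
  have arg1: "arg w 1 = lam * q * (1 - w)" by (simp add: algebra_simps)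
  have K1: "K w < 1" using K_le[OF w(2)] queue_stable by simp
  have LK: "1 - LST S (lam * q * (1 - w)) = K w * (1 - w)" using w by (simp add: K_def)
  then have LK': "LST S (lam * q * (1 - w)) - w = (1 - w) * (1 - K w)" by (simp add: algebra_simps)
  have "(\<lambda>n. LST S (arg w (z n))) \<longlonglongrightarrow> LST S (arg w 1)"
  proof (rule Lim_transform_bound[where g="\<lambda>n. m * (lam * (1 - q) * (1 - z n))" for n, THEN Lim_null[THEN iffD2]])
    show "\<forall>\<^sub>F n in sequentially. norm (LST S (arg w (z n)) - LST S (arg w 1)) \<le> norm (m * (lam * (1 - q) * (1 - z n)))"
    proof (intro always_eventually allI)
      fix n
      have "\<bar>LST S (arg w (z n)) - LST S (arg w 1)\<bar> \<le> m * \<bar>arg w (z n) - arg w 1\<bar>"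
        using w z(2)[of n] by (intro LST_dist arg_nonneg) auto
      also have "arg w (z n) - arg w 1 = lam * (1 - q) * (1 - z n)" by (simp add: algebra_simps)
      also have "m * \<bar>lam * (1 - q) * (1 - z n)\<bar> = norm (m * (lam * (1 - q) * (1 - z n)))"
        using mean_pos by (simp add: abs_mult)
      finally show "norm (LST S (arg w (z n)) - LST S (arg w 1)) \<le> norm (m * (lam * (1 - q) * (1 - z n)))" by simp
    qed
    have "(\<lambda>n. m * (lam * (1 - q) * (1 - z n))) \<longlonglongrightarrow> m * (lam * (1 - q) * (1 - 1))"
      by (intro tendsto_intros z)
    then show "(\<lambda>n. m * (lam * (1 - q) * (1 - z n))) \<longlonglongrightarrow> 0" by simp
  qed
  then have L: "(\<lambda>n. LST S (arg w (z n))) \<longlonglongrightarrow> LST S (lam * q * (1 - w))" by (simp only: arg1)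
  have nz: "LST S (lam * q * (1 - w)) - w \<noteq> 0" "1 - (1 - q) * 1 - q * w \<noteq> 0"
  proof -
    have "1 - (1 - q) * 1 - q * w = q * (1 - w)" by (simp add: algebra_simps)
    then show "1 - (1 - q) * 1 - q * w \<noteq> 0" using w q by simp
    show "LST S (lam * q * (1 - w)) - w \<noteq> 0" unfolding LK' using w K1 by simp
  qed
  have "(\<lambda>n. M_a lam q S w (z n) * M_b lam q S w (z n)) \<longlonglongrightarrow>
      1 / (lam * m) * ((1 - LST S (lam * q * (1 - w))) / (1 - (1 - q) * 1 - q * w)) *
      ((1 - lam * q * m) * ((1 - w) / (LST S (lam * q * (1 - w)) - w)))"
    unfolding M_a_def M_b_def
    using nz by (intro tendsto_mult tendsto_divide tendsto_diff tendsto_const L z h_tendsto) auto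
  also have "1 - (1 - q) * 1 - q * w = q * (1 - w)" by (simp add: algebra_simps)
  also have "1 / (lam * m) * ((1 - LST S (lam * q * (1 - w))) / (q * (1 - w))) *
      ((1 - lam * q * m) * ((1 - w) / (LST S (lam * q * (1 - w)) - w)))
      = (1 - lam * q * m) * K w / (lam * q * m * (1 - K w))"
  proof -
    have "1 - w \<noteq> 0" using w by simp
    then have "(1 - LST S (lam * q * (1 - w))) / (q * (1 - w)) = K w / q"
      and "(1 - w) / (LST S (lam * q * (1 - w)) - w) = 1 / (1 - K w)"
      unfolding LK LK' by auto
    then show ?thesis by (simp add: mult_ac)
  qed
  finally show ?thesis .
qed

end

section \<open>From the joint law to the tail of the queue length\<close>

lemma measurable_R_que: "R_que \<in> rq_space \<rightarrow>\<^sub>M count_space UNIV"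
  and measurable_R_orb: "R_orb \<in> rq_space \<rightarrow>\<^sub>M count_space UNIV"
  and measurable_I_ser: "I_ser \<in> rq_space \<rightarrow>\<^sub>M count_space UNIV"
proof -
  let ?N = "count_space (UNIV :: nat set)"
  let ?X = "\<lambda>x. (I_ser x, R_que x, R_orb x, residual x)"
  have X: "?X \<in> rq_space \<rightarrow>\<^sub>M (?N \<Otimes>\<^sub>M ?N \<Otimes>\<^sub>M ?N \<Otimes>\<^sub>M (borel :: real measure))"
    unfolding rq_space_def by (rule measurable_vimage_algebra1) (simp add: space_pair_measure)
  show "I_ser \<in> rq_space \<rightarrow>\<^sub>M ?N"
    using measurable_compose[OF X measurable_fst] by simp
  show "R_que \<in> rq_space \<rightarrow>\<^sub>M ?N"
    using measurable_compose[OF measurable_compose[OF X measurable_snd] measurable_fst] by simp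
  show "R_orb \<in> rq_space \<rightarrow>\<^sub>M ?N"
    using measurable_compose[OF measurable_compose[OF measurable_compose[OF X measurable_snd] measurable_snd] measurable_fst] by simp
qed

lemma (in prob_space) power_marginal_tendsto:
  fixes X Y :: "'a \<Rightarrow> nat"
  assumes [measurable]: "X \<in> M \<rightarrow>\<^sub>M count_space UNIV" "Y \<in> M \<rightarrow>\<^sub>M count_space UNIV"
    and z: "\<And>n. 0 \<le> z n" "\<And>n. z n < 1" "z \<longlonglongrightarrow> (1::real)" and w: "0 \<le> w" "w \<le> 1"
  shows "(\<lambda>n. \<integral>x. w ^ X x * z n ^ Y x \<partial>M) \<longlonglongrightarrow> (\<integral>x. w ^ X x \<partial>M)"
proof (rule integral_dominated_convergence[where w="\<lambda>_. 1"])
  show "AE x in M. (\<lambda>n. w ^ X x * z n ^ Y x) \<longlonglongrightarrow> w ^ X x"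
  proof (rule AE_I2)
    fix x
    have "(\<lambda>n. w ^ X x * z n ^ Y x) \<longlonglongrightarrow> w ^ X x * 1 ^ Y x"
      by (intro tendsto_mult tendsto_const tendsto_power z)
    then show "(\<lambda>n. w ^ X x * z n ^ Y x) \<longlonglongrightarrow> w ^ X x" by simp
  qed
  show "AE x in M. norm (w ^ X x * z n ^ Y x) \<le> 1" for n
    using z(1,2)[of n] w by (intro AE_I2) (auto simp: abs_mult intro!: mult_le_one power_le_one)
qed auto

text \<open>Pointwise this is the finite geometric sum over \<open>n < X x\<close>; the expectation
  is taken term by term.\<close>

lemma (in prob_space) tail_generating_function:
  fixes X :: "'a \<Rightarrow> nat"
  assumes [measurable]: "X \<in> M \<rightarrow>\<^sub>M count_space UNIV" and z: "0 \<le> z" "z < (1::real)"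
  shows "(\<lambda>n. z ^ n * prob {x \<in> space M. n < X x}) sums ((1 - (\<integral>x. z ^ X x \<partial>M)) / (1 - z))"
proof -
  have "(\<lambda>n. z ^ n * (\<integral>x. indicator {x \<in> space M. n < X x} x \<partial>M)) sums (\<integral>x. (1 - z ^ X x) / (1 - z) \<partial>M)"
  proof (rule sums_integral_power_series)
    show "AE x in M. (\<lambda>n. z ^ n * indicat_real {x \<in> space M. n < X x} x) sums ((1 - z ^ X x) / (1 - z))"
    proof (rule AE_I2)
      fix x assume x: "x \<in> space M"
      have "(\<lambda>n. if n \<in> {..<X x} then z ^ n else 0) sums (\<Sum>n<X x. z ^ n)"
        by (rule sums_If_finite_set) simp
      also have "(\<lambda>n. if n \<in> {..<X x} then z ^ n else 0) = (\<lambda>n. z ^ n * indicat_real {x \<in> space M. n < X x} x)"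
        using x by (auto simp: fun_eq_iff indicator_def)
      also have "(\<Sum>n<X x. z ^ n) = (1 - z ^ X x) / (1 - z)"
        using z by (simp add: sum_gp_strict)
      finally show "(\<lambda>n. z ^ n * indicat_real {x \<in> space M. n < X x} x) sums ((1 - z ^ X x) / (1 - z))" .
    qed
  qed (use z in \<open>auto simp: indicator_def\<close>)
  moreover have "(\<integral>x. (1 - z ^ X x) / (1 - z) \<partial>M) = (1 - (\<integral>x. z ^ X x \<partial>M)) / (1 - z)"
  proof -
    have "integrable M (\<lambda>x. z ^ X x)"
      by (rule integrable_const_bound[where B=1]) (use z in \<open>auto simp: power_le_one\<close>)
    then show ?thesis using z by (simp add: prob_space)
  qed
  moreover have "(\<integral>x. indicat_real {x \<in> space M. n < X x} x \<partial>M) = prob {x \<in> space M. n < X x}" for n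
    by (simp add: Int_def conj_ac cong: conj_cong)
  ultimately show ?thesis by (simp only:)
qed

lemma (in prob_space) tail_tendsto_zero:
  fixes X :: "'a \<Rightarrow> nat"
  assumes [measurable]: "X \<in> M \<rightarrow>\<^sub>M count_space UNIV"
  shows "(\<lambda>n. prob {x \<in> space M. n < X x}) \<longlonglongrightarrow> 0"
proof -
  have "(\<lambda>n. prob {x \<in> space M. n < X x}) \<longlonglongrightarrow> prob (\<Inter>n. {x \<in> space M. n < X x})"
    by (rule finite_Lim_measure_decseq) (auto simp: decseq_def)
  also have "(\<Inter>n. {x \<in> space M. n < X x}) = {}" by auto
  finally show ?thesis by simp
qed

text \<open>Regular variation passes from the product of power and \<open>L\<close> to the tail
  \<open>F\<close>, by writing \<open>F (x * t) / F t\<close> as a product of ratios with known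
  limits. The gain is monotonicity, which \<open>L\<close> need not have.\<close>

lemma regvar_tail_ratio:
  assumes tail: "F \<sim>[at_top] (\<lambda>t. t powr (- a) * L t)" and L: "slowly_varying L"
  shows "((\<lambda>t. F t / (t powr (- a) * L t)) \<longlongrightarrow> 1) at_top"
    and "0 < x \<Longrightarrow> ((\<lambda>t. F (x * t) / F t) \<longlongrightarrow> x powr - a) at_top"
proof -
  have Lpos: "0 < L t" if "0 < t" for t using L that by (simp add: slowly_varying_def)
  show A: "((\<lambda>t. F t / (t powr (- a) * L t)) \<longlongrightarrow> 1) at_top"
    by (rule asymp_equivD_strong[OF tail])
      (use eventually_gt_at_top[of 0] in eventually_elim, use Lpos in force)
  assume x: "0 < x"
  have xt: "filterlim (\<lambda>t. x * t) at_top at_top"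
    using x by (intro filterlim_tendsto_pos_mult_at_top[OF tendsto_const]) (auto simp: filterlim_ident)
  have "((\<lambda>t. (F (x * t) / ((x * t) powr (- a) * L (x * t))) / (F t / (t powr (- a) * L t)) *
      (x powr - a * (L (x * t) / L t))) \<longlongrightarrow> 1 / 1 * (x powr - a * 1)) at_top"
    using L x by (intro tendsto_mult tendsto_divide tendsto_const A filterlim_compose[OF A xt])
      (auto simp: slowly_varying_def)
  moreover have "\<forall>\<^sub>F t in at_top. (F (x * t) / ((x * t) powr (- a) * L (x * t))) / (F t / (t powr (- a) * L t)) *
      (x powr - a * (L (x * t) / L t)) = F (x * t) / F t"
    using eventually_gt_at_top[of 0]
  proof eventually_elim
    case (elim t)
    have "0 < L t" "0 < L (x * t)" using Lpos elim x by auto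
    then show ?case using elim x by (simp add: powr_mult)
  qed
  ultimately show "((\<lambda>t. F (x * t) / F t) \<longlongrightarrow> x powr - a) at_top"
    by (simp add: filterlim_cong)
qed

theorem mainTheorem2:
  fixes lam q \<mu> a :: real and S :: "real measure" and L :: "real \<Rightarrow> real"
    and \<nu> :: "rq_state measure"
  assumes "0 < lam" and "0 < q" and "q < 1" and "0 < \<mu>"
    and "real_distribution S" and "cdf S 0 = 0" and "integrable S (\<lambda>x. x)"
    and stable: "lam * mean_service S < 1"
    and steady: "rq_steady_state lam q \<mu> S \<nu>"
    and known: "choi_park lam q \<mu> S \<nu>"
    and "1 < a" and "slowly_varying L"
    and tail: "(\<lambda>t. measure S {t<..}) \<sim>[at_top] (\<lambda>t. t powr (- a) * L t)"
  shows "(\<lambda>j::nat. cond_prob \<nu> (\<lambda>x. R_que x > j) (\<lambda>x. I_ser x = 1)) \<sim>[sequentially]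
    (\<lambda>j. (lam * q) powr (a - 1) / ((1 - lam * q * mean_service S) * (a - 1) * mean_service S)
          * real j powr (- a + 1) * L (real j))"
proof -
  define c where "c = lam * q"
  have c: "0 < c" using assms by (simp add: c_def)
  interpret real_distribution S by fact
  have "AE x in S. x \<notin> {..0}"
    using \<open>cdf S 0 = 0\<close> by (intro AE_not_in) (auto simp: cdf_def emeasure_eq_measure null_sets_def)
  then have AE_pos: "AE x in S. 0 < x" by eventually_elim auto
  interpret retrial_queue S lam q
    by unfold_locales (use assms AE_pos c in \<open>auto simp: c_def\<close>)
  define F where "F t = measure S {t<..}" for t
  have F_anti: "F t \<le> F s" if "s \<le> t" for s t
    unfolding F_def using that by (intro finite_measure_mono) auto
  note F_lim = regvar_tail_ratio[OF tail \<open>slowly_varying L\<close>, folded F_def]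
  have Lpos: "0 < L t" if "0 < t" for t
    using \<open>slowly_varying L\<close> that by (simp add: slowly_varying_def)
  \<comment> \<open>The equivalence gives positivity far out only; monotonicity carries it back to
    every \<open>t\<close>.\<close>
  have F_pos: "0 < F t" for t
  proof -
    have "\<forall>\<^sub>F t in at_top. 0 < F t / (t powr (- a) * L t)"
      by (rule order_tendstoD[OF F_lim(1)]) simp
    then have "\<forall>\<^sub>F s in at_top. 0 < F s \<and> t \<le> s"
      using eventually_gt_at_top[of 0] eventually_ge_at_top[of t]
    proof eventually_elim
      case (elim s)
      then show ?case using Lpos[of s] by (simp add: zero_less_divide_iff mult_less_0_iff)
    qed
    then obtain s where "0 < F s" "t \<le> s"
      using eventually_happens'[OF trivial_limit_at_top_linorder] by blast
    then show ?thesis using F_anti by (meson less_le_trans)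
  qed
  have scale: "filterlim (\<lambda>t. t / c) at_top at_top"
    using c by real_asymp
  interpret R: regvar_service_mean S "lam * q" a
  proof unfold_locales
    fix x :: real assume x: "0 < x"
    have "((\<lambda>t. F (x * (t / c)) / F (t / c)) \<longlongrightarrow> x powr - a) at_top"
      by (rule filterlim_compose[OF F_lim(2)[OF x] scale])
    then show "((\<lambda>t. measure S {x * t / (lam * q)<..} / measure S {t / (lam * q)<..}) \<longlongrightarrow> x powr - a) at_top"
      by (simp add: F_def c_def)
  next
    fix t show "0 < measure S {t / (lam * q)<..}" using F_pos by (simp add: F_def)
  next
    fix s t :: real assume "s \<le> t"
    then show "measure S {t / (lam * q)<..} \<le> measure S {s / (lam * q)<..}"
      using F_anti[of "s / c" "t / c"] c by (simp add: F_def c_def divide_right_mono)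
  qed (use assms queue_stable in auto)

  interpret N: prob_space \<nu> using steady by (simp add: rq_steady_state_def)
  have sets_\<nu>: "sets \<nu> = sets rq_space" using steady by (simp add: rq_steady_state_def)
  have meas [measurable]: "R_que \<in> \<nu> \<rightarrow>\<^sub>M count_space UNIV" "R_orb \<in> \<nu> \<rightarrow>\<^sub>M count_space UNIV"
      "I_ser \<in> \<nu> \<rightarrow>\<^sub>M count_space UNIV"
    using measurable_R_que measurable_R_orb measurable_I_ser
    by (simp_all add: measurable_cong_sets[OF sets_\<nu> refl])
  define B where "B = {x \<in> space \<nu>. I_ser x = 1}"
  have B [measurable]: "B \<in> sets \<nu>" unfolding B_def by measurable
  have muB: "measure \<nu> B = lam * m" using known by (simp add: choi_park_def B_def)
  have B0: "emeasure \<nu> B \<noteq> 0" "emeasure \<nu> B \<noteq> \<infinity>"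
    using muB \<open>0 < lam\<close> mean_pos by (auto simp: N.emeasure_eq_measure)
  define U where "U = uniform_measure \<nu> B"
  interpret U: prob_space U
    unfolding U_def by (rule prob_space_uniform_measure[OF B0])
  have sets_U: "sets U = sets \<nu>" and space_U: "space U = space \<nu>" by (auto simp: U_def)
  have measU [measurable]: "R_que \<in> U \<rightarrow>\<^sub>M count_space UNIV" "R_orb \<in> U \<rightarrow>\<^sub>M count_space UNIV"
    using meas by (simp_all add: measurable_cong_sets[OF sets_U refl])
  define Q where "Q j = measure U {x \<in> space U. j < R_que x}" for j
  have Q_cond: "cond_prob \<nu> (\<lambda>x. R_que x > j) (\<lambda>x. I_ser x = 1) = Q j" for j
  proof -
    have "Q j = measure \<nu> (B \<inter> {x \<in> space \<nu>. j < R_que x}) / measure \<nu> B"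
      unfolding Q_def space_U unfolding U_def by (rule measure_uniform_measure[OF B0]) measurable
    also have "B \<inter> {x \<in> space \<nu>. j < R_que x} = {x \<in> space \<nu>. j < R_que x \<and> I_ser x = 1}"
      by (auto simp: B_def)
    finally show ?thesis by (simp add: cond_prob_def B_def)
  qed

  define zs where "zs n = 1 - 1 / real (Suc n)" for n
  have zs: "0 \<le> zs n" "zs n < 1" for n by (auto simp: zs_def)
  have zs1: "zs \<longlonglongrightarrow> 1" unfolding zs_def by real_asymp
  have pgf: "(\<integral>x. w ^ R_que x \<partial>U) = (1 - lam * q * m) * K w / (lam * q * m * (1 - K w))"
    if w: "0 < w" "w < 1" for w
  proof (rule LIMSEQ_unique)
    show "(\<lambda>n. \<integral>x. w ^ R_que x * zs n ^ R_orb x \<partial>U) \<longlonglongrightarrow> (\<integral>x. w ^ R_que x \<partial>U)"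
      by (rule U.power_marginal_tendsto[OF measU zs zs1]) (use w in auto)
    have "(\<lambda>n. M_a lam q S w (zs n) * M_b lam q S w (zs n) * M_c lam q S (zs n) * R_0 lam q \<mu> S (zs n))
        \<longlonglongrightarrow> (1 - lam * q * m) * K w / (lam * q * m * (1 - K w)) * 1 * 1"
      using w by (intro tendsto_mult[OF tendsto_mult] M_a_M_b_tendsto M_c_tendsto R_0_tendsto zs zs1) auto
    \<comment> \<open>Since \<open>w < 1\<close> and \<open>h (zs n)\<close> tends to 1, the
      excluded case \<open>z1 = h z2\<close> of the formula is eventually avoided.\<close>
    moreover have "\<forall>\<^sub>F n in sequentially. w < h (zs n)"
      by (rule order_tendstoD(1)[OF h_tendsto[OF zs(2) zs1] w(2)])
    then have "\<forall>\<^sub>F n in sequentially.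
        M_a lam q S w (zs n) * M_b lam q S w (zs n) * M_c lam q S (zs n) * R_0 lam q \<mu> S (zs n)
        = (\<integral>x. w ^ R_que x * zs n ^ R_orb x \<partial>U)"
    proof eventually_elim
      case (elim n)
      then show ?case using known w zs[of n] by (simp add: choi_park_def U_def B_def)
    qed
    ultimately show "(\<lambda>n. \<integral>x. w ^ R_que x * zs n ^ R_orb x \<partial>U)
        \<longlonglongrightarrow> (1 - lam * q * m) * K w / (lam * q * m * (1 - K w))"
      by (simp add: filterlim_cong)
  qed
  have gf: "(\<lambda>j. z ^ j * Q j) sums ((lam * q * m - K z) / (lam * q * m * (1 - K z) * (1 - z)))"
    if z: "0 < z" "z < 1" for z
  proof -
    have K1: "1 - K z \<noteq> 0" using K_le[OF z(2)] queue_stable by simp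
    have cm: "lam * q * m \<noteq> 0" using lam_pos q mean_pos by simp
    have "1 - (1 - r) * k / (r * (1 - k)) = (r - k) / (r * (1 - k))" if "r \<noteq> 0" "1 - k \<noteq> 0" for r k :: real
      using that by (simp add: field_simps)
    from this[OF cm K1]
    have "(1 - (\<integral>x. z ^ R_que x \<partial>U)) / (1 - z) = (lam * q * m - K z) / (lam * q * m * (1 - K z) * (1 - z))"
      unfolding pgf[OF z] by simp
    then show ?thesis
      using U.tail_generating_function[OF measU(1), of z] z unfolding Q_def by simp
  qed
  have Q_lim: "(\<lambda>j. Q j / (real j * F (real j / c))) \<longlonglongrightarrow> 1 / (c * m * (1 - c * m) * (a - 1))"
    using R.geometric_compound_tail[OF _ _ gf] U.tail_tendsto_zero[OF measU(1)]
    unfolding F_def c_def Q_def by simp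
  have "(\<lambda>j. F (1 / c * real j) / F (real j)) \<longlonglongrightarrow> (1 / c) powr - a"
    using c by (intro filterlim_compose[OF F_lim(2) filterlim_real_sequentially]) auto
  \<comment> \<open>The source of the power of \<open>c\<close>: undoing the scaling by
    \<open>c\<close> gives \<open>c powr a\<close>, of which the factor \<open>1 / (c * m)\<close>
    in \<open>Q_lim\<close> takes one power.\<close>
  then have F_scale: "(\<lambda>j. F (real j / c) / F (real j)) \<longlonglongrightarrow> c powr a"
    using c by (simp add: powr_divide powr_minus)
  define C where "C = c powr (a - 1) / ((1 - c * m) * (a - 1) * m)"
  have cm: "c * m < 1" using queue_stable by (simp add: c_def)
  have C: "0 < C" using c cm mean_pos \<open>1 < a\<close> by (simp add: C_def)
  have "(\<lambda>j. Q j / (real j * F (real j / c)) * (F (real j / c) / F (real j)) *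
      (F (real j) / (real j powr (- a) * L (real j))) / C)
      \<longlonglongrightarrow> 1 / (c * m * (1 - c * m) * (a - 1)) * c powr a * 1 / C"
    using C by (intro tendsto_mult tendsto_divide tendsto_const Q_lim F_scale
        filterlim_compose[OF F_lim(1) filterlim_real_sequentially]) auto
  also have "1 / (c * m * (1 - c * m) * (a - 1)) * c powr a * 1 / C = 1"
  proof -
    have "c powr (a - 1) = c powr a / c" using c by (simp add: powr_diff)
    then show ?thesis using c cm mean_pos \<open>1 < a\<close> by (simp add: C_def)
  qed
  finally have lim: "(\<lambda>j. Q j / (real j * F (real j / c)) * (F (real j / c) / F (real j)) *
      (F (real j) / (real j powr (- a) * L (real j))) / C) \<longlonglongrightarrow> 1" .
  have "\<forall>\<^sub>F j in sequentially. Q j / (real j * F (real j / c)) * (F (real j / c) / F (real j)) *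
      (F (real j) / (real j powr (- a) * L (real j))) / C = Q j / (C * real j powr (- a + 1) * L (real j))"
    using eventually_gt_at_top[of 0]
  proof eventually_elim
    case (elim j)
    have nz: "F (real j / c) \<noteq> 0" "F (real j) \<noteq> 0" using F_pos[of "real j / c"] F_pos[of "real j"] by auto
    have "real j powr (- a + 1) = real j * real j powr - a" using elim by (simp add: powr_diff powr_minus divide_inverse)
    then show ?case using nz by (simp add: mult_ac)
  qed
  with lim have "(\<lambda>j. Q j / (C * real j powr (- a + 1) * L (real j))) \<longlonglongrightarrow> 1"
    by (simp add: filterlim_cong)
  then show ?thesis
    unfolding Q_cond C_def c_def by (rule asymp_equivI')
qed

end
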